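(* Let $x_0\in\mathcal X$ and let the assumptions (A1)–(A5) of the context be satisfied. Given a feasible initialization $\hat{\mathbf u}_0$, $v_0$, and (positive) step sizes $$\gamma_u\le \frac{2}{l_u+\alpha_u},\qquad \frac{\|A\|-1}{\|A\|\,\alpha_x}<\gamma_x\le\frac{2}{l_x+\alpha_x},$$ the dynamic regret $\mathcal R=\sum_{t=0}^T\big(L_t(x_t,u_t)-L_t(x_t^*,u_t^* )\big)$ of Algorithm 1 (described in the context) can be upper bounded by $$\mathcal R\;\le\; C_0+C_\theta\sum_{t=0}^T\|\theta_t-\theta_{t-1}\|+C_\eta\sum_{t=0}^T\|\eta_t-\eta_{t-1}\|,$$ for some constants $C_0,C_\theta,C_\eta>0$ independent of $T$. Moreover, $x_t\in\mathcal X$ and $u_t\in\mathcal U$ for all $t\in\{0,\dots,T\}$.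
   Context: **Notation.** $\|\cdot\|$ is the Euclidean norm for vectors and the induced norm for matrices. For a set $\mathcal S$, $\Pi_{\mathcal S}(x)=\arg\min_{s\in\mathcal S}\|x-s\|^2$ is the projection onto $\mathcal S$. **System.** $x_{t+1}=Ax_t+Bu_t$ with given initial state $x_0$, where $x_t\in\mathbb R^n$, $u_t\in\mathbb R^m$, and $A\in\mathbb R^{n\times n}$, $B\in\mathbb R^{n\times m}$ are known. State and input constraint sets are $\mathcal X\subset\mathbb R^n$ and $\mathcal U\subset\mathbb R^m$. $T\in\mathbb N$ is the horizon. **Assumptions.** (A1) $\mathcal X=\{x\in\mathbb R^n: C_xx\le d_x\}$ and $\mathcal U=\{u\in\mathbb R^m: C_uu\le d_u\}$ are compact convex polytopes with $0$ in their interior. (A2) For every $t\in\{0,\dots,T\}$ the cost function $L_t:\mathcal X\times\mathcal U\to\mathbb R$ satisfies $L_t(x,u)=f_t^x(x)+f_t^u(u)$, where $f_t^x:\mathcal X\to\mathbb R$ is $\alpha_x$-strongly convex and $l_x$-smooth (differentiable with $l_x$-Lipschitz gradient) for all $x\in\mathcal X$, and $f_t^u:\mathcal U\to\mathbb R$ is $\alpha_u$-strongly convex and $l_u$-smooth for all $u\in\mathcal U$. The constants $\alpha_x,l_x,\alpha_u,l_u$ do not depend on $t$. (A3) Let $\theta_t=\arg\min_{x\in\mathcal X}f_t^x(x)$ and $\eta_t=\arg\min_{u\in\mathcal U}f_t^u(u)$. Let $\bar{\mathcal X}=\{x\in\mathbb R^n: C_x(x+\delta r)\le d_x\ \ \forall\,\|r\|\le1\}$,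 where $\delta>0$. For all $t\in\{0,\dots,T\}$: $\theta_t\in\bar{\mathcal X}$, $\eta_t\in\mathcal U$, and $\theta_t=A\theta_t+B\eta_t$. (A4) $(A,B)$ is controllable, i.e. $\operatorname{rank}(B\ AB\ \cdots\ A^{n-1}B)=n$, and $\|A\|<\frac{l_x+\alpha_x}{l_x-\alpha_x}$ (no restriction on $\|A\|$ if $l_x=\alpha_x$). (A5) There is a constant $\mu\in\mathbb N$ such that for every two states $x,y\in\mathcal X$ there is an input sequence $\mathbf u=\{u^{(1)},\dots,u^{(\mu)}\}$ that is feasible from $x$ and satisfies $A^\mu x+S_cu=y$, where $S_c=(B\ AB\ \cdots\ A^{\mu-1}B)$. **Sequences.** For a sequence $\mathbf u=\{u^{(1)},\dots,u^{(\mu)}\}$ with $u^{(i)}\in\mathbb R^m$, the non-bold $u$ denotes the stacked vector $u=((u^{(\mu)})^\top,\dots,(u^{(1)})^\top)^\top$; thus $A^\mu x+S_cu$ is the state reached from $x$ after applying $u^{(1)},\dots,u^{(\mu)}$ in this order. $\mathbf u$ is feasible from $x$ if all $u^{(i)}\in\mathcal U$ and all states visited when applying $\mathbf u$ from $x$ lie in $\mathcal X$. **Algorithm 1.** Given are step sizes $\gamma_u,\gamma_x$ and an initialization $\hat{\mathbf u}_0=\{\hat u_0^{(1)},\dots,\hat u_0^{(\mu)}\}$, $v_0$; the initialization is feasible if $\hat{\mathbf u}_0$ is feasible from $x_0$ and $v_0\in\mathcal U$. At time $0$ the input $u_0=\hat u_0^{(1)}$ is applied, and the predicted state is $\hat x_\mu=A^\mu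 x_0+S_c\hat u_0$. At each time $t\in\{1,\dots,T\}$ the state $x_t$ is measured, and with the previous cost $L_{t-1}$ the algorithm computes: 1. $v_t=\Pi_{\mathcal U}(v_{t-1}-\gamma_u\nabla f^u_{t-1}(v_{t-1}))$; 2. $\hat{\mathbf v}_t=\{\hat u_{t-1}^{(2)},\dots,\hat u_{t-1}^{(\mu)},v_t\}$; 3. $\hat x_{t+\mu}=A^\mu x_t+S_c\hat v_t$; 4. $x^\pi_{t+\mu}=\Pi_{\bar{\mathcal X}}(\hat x_{t+\mu}-\gamma_x\nabla f^x_{t-1}(\hat x_{t+\mu}))$; 5. if $\|\hat x_{t+\mu}-x^\pi_{t+\mu}\|=0$, set $\alpha_t=0$; otherwise set $\bar\delta_t=\delta/\|\hat x_{t+\mu}-x^\pi_{t+\mu}\|$, $\alpha_t=1/(1+\bar\delta_t)$, and find a sequence $\mathbf g_t=\{g_t^{(1)},\dots,g_t^{(\mu)}\}\in\mathcal U^\mu$ that is feasible from $x_t$ and satisfies $A^\mu x_t+S_cg_t=x^\pi_{t+\mu}+\bar\delta_t(x^\pi_{t+\mu}-\hat x_{t+\mu})$; 6. $\hat u_t=(1-\alpha_t)\hat v_t+\alpha_tg_t$ (so $\hat u_t=\hat v_t$ if $\alpha_t=0$); 7. $u_t=\hat u_t^{(1)}$ is applied, so $x_{t+1}=Ax_t+Bu_t$; afterwards $L_t$ is revealed. **Benchmark.** $(x_t^*,u_t^* )$ is the solution of minimizing $\sum_{t=0}^TL_t(x_t,u_t)$ over states in $\mathcal X$ and inputs in $\mathcal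 U$ subject to $x_{t+1}=Ax_t+Bu_t$, with initial state $x_0$. **Convention.** For $t<0$, $\eta_t=v_0$ and $\theta_t=\hat x_\mu$.
   Formalization: Added: the input costs f_t^u share a Lipschitz constant G on U, on which the constants may depend (not needed for feasibility); state costs satisfy (A2) on a convex D containing X, and the predicted states where gradients are taken lie in D. Without these the claim fails or is undefined. *)

theory Defs
  imports "HOL-Analysis.Analysis"
begin

section \<open>Functions on a convex set\<close>

text \<open>
  A function \<open>f : S \<rightarrow> \<real>\<close> is represented by a total function of which only the values
  on \<open>S\<close> are used; in particular the gradient is the one relative to \<open>S\<close>. It is unique
  if \<open>S\<close> is convex with nonempty interior, also at boundary points of \<open>S\<close>.
\<close>

definition gradient_within :: "('a::real_inner \<Rightarrow> real) \<Rightarrow> 'a set \<Rightarrow> 'a \<Rightarrow> 'a" where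
  "gradient_within f S x = (THE g. (f has_derivative (\<lambda>h. g \<bullet> h)) (at x within S))"

definition strongly_convex_on :: "real \<Rightarrow> 'a::real_inner set \<Rightarrow> ('a \<Rightarrow> real) \<Rightarrow> bool" where
  "strongly_convex_on \<alpha> S f \<longleftrightarrow> convex S \<and>
     (\<forall>x\<in>S. \<forall>y\<in>S. \<forall>s\<in>{0..1}.
        f ((1 - s) *\<^sub>R x + s *\<^sub>R y)
          \<le> (1 - s) * f x + s * f y - \<alpha> / 2 * s * (1 - s) * (norm (x - y))\<^sup>2)"

definition smooth_fun_on :: "real \<Rightarrow> 'a::real_inner set \<Rightarrow> ('a \<Rightarrow> real) \<Rightarrow> bool" where
  "smooth_fun_on l S f \<longleftrightarrow>
     (\<forall>x\<in>S. f differentiable (at x within S)) \<and> l-lipschitz_on S (gradient_within f S)"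


section \<open>Linear systems with constraints\<close>

text \<open>The product on \<^typ>\<open>real^'n^'n\<close> inherited from the class \<open>times\<close> is componentwise, so
  \<open>(^)\<close> is not the matrix power.\<close>

primrec matpow :: "real^'n^'n \<Rightarrow> nat \<Rightarrow> real^'n^'n" where
  "matpow A 0 = mat 1"
| "matpow A (Suc k) = A ** matpow A k"

text \<open>The matrix \<open>(B  AB  \<dots>  A\<^sup>n\<^sup>-\<^sup>1B)\<close>. Its columns are indexed by pairs of a block and a column
  of \<open>B\<close>; the blocks are numbered by the bijection \<open>to_nat_on UNIV\<close> from \<open>'n\<close> onto
  \<open>{..<CARD('n)}\<close>.\<close>

definition controllability_matrix :: "real^'n^'n \<Rightarrow> real^'m^'n \<Rightarrow> real^('n \<times> 'm)^'n" where
  "controllability_matrix A B =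
     (\<chi> i j. (matpow A (to_nat_on (UNIV :: 'n set) (fst j)) ** B) $ i $ snd j)"

definition controllable :: "real^'n^'n \<Rightarrow> real^'m^'n \<Rightarrow> bool" where
  "controllable A B \<longleftrightarrow> rank (controllability_matrix A B) = CARD('n)"

text \<open>Input sequences \<open>u\<^sup>(\<^sup>1\<^sup>), \<dots>, u\<^sup>(\<^sup>\<mu>\<^sup>)\<close> are functions on \<^typ>\<open>nat\<close> of which only the values at
  \<open>1, \<dots>, \<mu>\<close> matter.\<close>

primrec state :: "real^'n^'n \<Rightarrow> real^'m^'n \<Rightarrow> real^'n \<Rightarrow> (nat \<Rightarrow> real^'m) \<Rightarrow> nat \<Rightarrow> real^'n" where
  "state A B x us 0 = x"
| "state A B x us (Suc k) = A *v state A B x us k + B *v us (Suc k)"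

text \<open>\<open>S\<^sub>c u\<close> with \<open>S\<^sub>c = (B  AB  \<dots>  A\<^sup>\<mu>\<^sup>-\<^sup>1B)\<close> and the stacked vector \<open>u = (u\<^sup>(\<^sup>\<mu>\<^sup>), \<dots>, u\<^sup>(\<^sup>1\<^sup>))\<close>.\<close>

definition Sc_apply :: "real^'n^'n \<Rightarrow> real^'m^'n \<Rightarrow> nat \<Rightarrow> (nat \<Rightarrow> real^'m) \<Rightarrow> real^'n" where
  "Sc_apply A B \<mu> us = (\<Sum>k<\<mu>. (matpow A k ** B) *v us (\<mu> - k))"

definition predicted ::
    "real^'n^'n \<Rightarrow> real^'m^'n \<Rightarrow> nat \<Rightarrow> real^'n \<Rightarrow> (nat \<Rightarrow> real^'m) \<Rightarrow> real^'n" where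
  "predicted A B \<mu> x us = matpow A \<mu> *v x + Sc_apply A B \<mu> us"

lemma predicted_eq_state: "predicted A B \<mu> x us = state A B x us \<mu>"
proof (induction \<mu>)
  case 0
  show ?case by (simp add: predicted_def Sc_apply_def)
next
  case (Suc k)
  have "A *v Sc_apply A B k us = (\<Sum>j<k. (matpow A (Suc j) ** B) *v us (Suc k - Suc j))"
    by (simp add: Sc_apply_def linear_sum[OF matrix_vector_mul_linear] o_def
        matrix_vector_mul_assoc matrix_mul_assoc)
  then have "Sc_apply A B (Suc k) us = A *v Sc_apply A B k us + B *v us (Suc k)"
    unfolding Sc_apply_def[of A B "Suc k"] by (subst sum.lessThan_Suc_shift) simp
  then show ?case using Suc.IH
    by (simp add: predicted_def matrix_vector_right_distrib matrix_vector_mul_assoc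
        flip: Suc.IH)
qed

definition feasible_from ::
    "real^'n^'n \<Rightarrow> real^'m^'n \<Rightarrow> (real^'n) set \<Rightarrow> (real^'m) set \<Rightarrow> nat
      \<Rightarrow> real^'n \<Rightarrow> (nat \<Rightarrow> real^'m) \<Rightarrow> bool" where
  "feasible_from A B X U \<mu> x us \<longleftrightarrow>
     (\<forall>i\<in>{1..\<mu>}. us i \<in> U) \<and> (\<forall>k\<in>{1..\<mu>}. state A B x us k \<in> X)"


section \<open>The online algorithm\<close>

text \<open>
  One iteration at time \<open>t \<ge> 1\<close>: from the measured state \<open>xt\<close>, the previous costs \<open>fxp, fup\<close> and
  the previous \<open>vp = v\<^sub>t\<^sub>-\<^sub>1\<close>, \<open>up = \<hat>u\<^sub>t\<^sub>-\<^sub>1\<close> to \<open>vt = v\<^sub>t\<close>, \<open>ut = \<hat>u\<^sub>t\<close>.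

  The predicted state \<open>xh = \<hat>x\<^sub>t\<^sub>+\<^sub>\<mu>\<close>, at which the gradient of the state cost is evaluated, need not
  lie in \<open>X\<close>. Hence the state costs have their own domain \<open>D \<supseteq> X\<close>, and the iteration
  is only defined if \<open>xh \<in> D\<close>. (\<open>D = X\<close> and \<open>D = UNIV\<close> are both instances.)

  The sequence \<open>g\<close> is any solution of the steering problem, if there is a solution; solvability of
  that problem is not presupposed.
\<close>

definition algorithm_step ::
    "real^'n^'n \<Rightarrow> real^'m^'n \<Rightarrow> (real^'n) set \<Rightarrow> (real^'m) set \<Rightarrow> (real^'n) set \<Rightarrow> (real^'n) set
      \<Rightarrow> real \<Rightarrow> nat \<Rightarrow> real \<Rightarrow> real \<Rightarrow> (real^'n \<Rightarrow> real) \<Rightarrow> (real^'m \<Rightarrow> real)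
      \<Rightarrow> real^'n \<Rightarrow> real^'m \<Rightarrow> (nat \<Rightarrow> real^'m) \<Rightarrow> real^'m \<Rightarrow> (nat \<Rightarrow> real^'m) \<Rightarrow> bool" where
  "algorithm_step A B X U Xbar D \<delta> \<mu> \<gamma>x \<gamma>u fxp fup xt vp up vt ut \<longleftrightarrow>
     vt = closest_point U (vp - \<gamma>u *\<^sub>R gradient_within fup U vp) \<and>
     (let vh = (\<lambda>i. if i < \<mu> then up (i + 1) else vt);
          xh = predicted A B \<mu> xt vh;
          xp = closest_point Xbar (xh - \<gamma>x *\<^sub>R gradient_within fxp D xh)
      in xh \<in> D \<and>
         (if norm (xh - xp) = 0 then \<forall>i\<in>{1..\<mu>}. ut i = vh i
          else let db = \<delta> / norm (xh - xp);
                   a = 1 / (1 + db);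
                   steers = (\<lambda>g. feasible_from A B X U \<mu> xt g \<and>
                                 predicted A B \<mu> xt g = xp + db *\<^sub>R (xp - xh))
               in \<exists>g. ((\<exists>g'. steers g') \<longrightarrow> steers g) \<and>
                      (\<forall>i\<in>{1..\<mu>}. ut i = (1 - a) *\<^sub>R vh i + a *\<^sub>R g i)))"

definition algorithm_run ::
    "real^'n^'n \<Rightarrow> real^'m^'n \<Rightarrow> (real^'n) set \<Rightarrow> (real^'m) set \<Rightarrow> (real^'n) set \<Rightarrow> (real^'n) set
      \<Rightarrow> real \<Rightarrow> nat \<Rightarrow> real \<Rightarrow> real \<Rightarrow> real^'n \<Rightarrow> (nat \<Rightarrow> real^'m) \<Rightarrow> real^'m \<Rightarrow> nat
      \<Rightarrow> (nat \<Rightarrow> real^'n \<Rightarrow> real) \<Rightarrow> (nat \<Rightarrow> real^'m \<Rightarrow> real)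
      \<Rightarrow> (nat \<Rightarrow> real^'n) \<Rightarrow> (nat \<Rightarrow> real^'m) \<Rightarrow> bool" where
  "algorithm_run A B X U Xbar D \<delta> \<mu> \<gamma>x \<gamma>u x0 uinit v0 T fx fu x u \<longleftrightarrow>
     (\<exists>v uh.
        x 0 = x0 \<and> v 0 = v0 \<and> (\<forall>i\<in>{1..\<mu>}. uh 0 i = uinit i) \<and>
        (\<forall>t\<in>{1..T}. algorithm_step A B X U Xbar D \<delta> \<mu> \<gamma>x \<gamma>u (fx (t - 1)) (fu (t - 1))
                       (x t) (v (t - 1)) (uh (t - 1)) (v t) (uh t)) \<and>
        (\<forall>t\<in>{0..T}. u t = uh t 1 \<and> x (t + 1) = A *v x t + B *v u t))"


section \<open>Costs, benchmark and regret\<close>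

definition costs_regular ::
    "(real^'n) set \<Rightarrow> (real^'m) set \<Rightarrow> real \<Rightarrow> real \<Rightarrow> real \<Rightarrow> real \<Rightarrow> nat
      \<Rightarrow> (nat \<Rightarrow> real^'n \<Rightarrow> real) \<Rightarrow> (nat \<Rightarrow> real^'m \<Rightarrow> real) \<Rightarrow> bool" where
  "costs_regular D U \<alpha>x lx \<alpha>u lu T fx fu \<longleftrightarrow>
     (\<forall>t\<in>{0..T}. strongly_convex_on \<alpha>x D (fx t) \<and> smooth_fun_on lx D (fx t) \<and>
                  strongly_convex_on \<alpha>u U (fu t) \<and> smooth_fun_on lu U (fu t))"

definition minimizers_steady ::
    "real^'n^'n \<Rightarrow> real^'m^'n \<Rightarrow> (real^'n) set \<Rightarrow> (real^'m) set \<Rightarrow> (real^'n) set \<Rightarrow> nat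
      \<Rightarrow> (nat \<Rightarrow> real^'n \<Rightarrow> real) \<Rightarrow> (nat \<Rightarrow> real^'m \<Rightarrow> real) \<Rightarrow> bool" where
  "minimizers_steady A B X U Xbar T fx fu \<longleftrightarrow>
     (\<forall>t\<in>{0..T}. let \<theta> = arg_min_on (fx t) X; \<eta> = arg_min_on (fu t) U
                  in \<theta> \<in> Xbar \<and> \<eta> \<in> U \<and> \<theta> = A *v \<theta> + B *v \<eta>)"

definition total_cost ::
    "nat \<Rightarrow> (nat \<Rightarrow> real^'n \<Rightarrow> real) \<Rightarrow> (nat \<Rightarrow> real^'m \<Rightarrow> real)
      \<Rightarrow> (nat \<Rightarrow> real^'n) \<times> (nat \<Rightarrow> real^'m) \<Rightarrow> real" where
  "total_cost T fx fu = (\<lambda>(x, u). \<Sum>t=0..T. fx t (x t) + fu t (u t))"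

definition benchmark_solution ::
    "real^'n^'n \<Rightarrow> real^'m^'n \<Rightarrow> (real^'n) set \<Rightarrow> (real^'m) set \<Rightarrow> real^'n \<Rightarrow> nat
      \<Rightarrow> (nat \<Rightarrow> real^'n \<Rightarrow> real) \<Rightarrow> (nat \<Rightarrow> real^'m \<Rightarrow> real)
      \<Rightarrow> (nat \<Rightarrow> real^'n) \<Rightarrow> (nat \<Rightarrow> real^'m) \<Rightarrow> bool" where
  "benchmark_solution A B X U x0 T fx fu xs us \<longleftrightarrow>
     is_arg_min (total_cost T fx fu)
       (\<lambda>(x, u). x 0 = x0 \<and> (\<forall>t\<in>{0..T}. x t \<in> X \<and> u t \<in> U) \<and>
                 (\<forall>t<T. x (t + 1) = A *v x t + B *v u t))
       (xs, us)"

definition regret ::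
    "nat \<Rightarrow> (nat \<Rightarrow> real^'n \<Rightarrow> real) \<Rightarrow> (nat \<Rightarrow> real^'m \<Rightarrow> real)
      \<Rightarrow> (nat \<Rightarrow> real^'n) \<Rightarrow> (nat \<Rightarrow> real^'m) \<Rightarrow> (nat \<Rightarrow> real^'n) \<Rightarrow> (nat \<Rightarrow> real^'m) \<Rightarrow> real" where
  "regret T fx fu x u xs us =
     (\<Sum>t=0..T. (fx t (x t) + fu t (u t)) - (fx t (xs t) + fu t (us t)))"

text \<open>\<open>\<Sum>\<^sub>t \<parallel>s\<^sub>t - s\<^sub>t\<^sub>-\<^sub>1\<parallel>\<close> over \<open>t = 0, \<dots>, T\<close>, with \<open>s\<^sub>-\<^sub>1 = z\<close>.\<close>

definition path_variation :: "nat \<Rightarrow> 'a::real_normed_vector \<Rightarrow> (nat \<Rightarrow> 'a) \<Rightarrow> real" where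
  "path_variation T z s = (\<Sum>t=0..T. norm (s t - (case t of 0 \<Rightarrow> z | Suc k \<Rightarrow> s k)))"

text \<open>
  Smoothness on the compact set \<open>U\<close> makes every single \<open>fu t\<close> Lipschitz on \<open>U\<close>, but not with a
  constant common to all costs with parameters \<open>\<alpha>\<^sub>u, l\<^sub>u\<close>, since the minimizer over \<open>U\<close> may lie on
  the boundary with an arbitrarily large gradient. (The state costs have a common constant on \<open>X\<close>,
  as their minimizers over \<open>X\<close> are interior points.) Constants in a regret bound can
  therefore be independent of the horizon only for a given Lipschitz constant of the input costs.
\<close>

definition input_costs_lipschitz ::
    "real \<Rightarrow> (real^'m) set \<Rightarrow> nat \<Rightarrow> (nat \<Rightarrow> real^'m \<Rightarrow> real) \<Rightarrow> bool" where
  "input_costs_lipschitz G U T fu \<longleftrightarrow> (\<forall>t\<in>{0..T}. G-lipschitz_on U (fu t))"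

end

theory Submission
  imports Defs
begin

text \<open>
  A gradient step of size \<open>\<gamma> \<le> 2 / (l + \<alpha>)\<close> contracts by \<open>1 - \<gamma>\<alpha>\<close>. The usual derivation from
  co-coercivity of the gradient needs a cost on the whole space; on a convex set it is carried out
  on small balls in the interior and transported along segments and to the boundary.

  The step-6 interpolation makes the corrected input sequence \<open>\<hat>u\<^sub>t\<close> end in the projected point
  \<open>p\<^sub>t = x\<^sup>\<pi>\<^sub>t\<^sub>+\<^sub>\<mu>\<close>. Since \<open>\<theta> = A\<theta> + B\<eta>\<close> at the minimizers, the next predicted state is
  \<open>A p\<^sub>t + B v\<^sub>t\<^sub>+\<^sub>1\<close>, whose distance to \<open>\<theta>\<^sub>t\<close> is at most \<open>\<parallel>A\<parallel> \<parallel>p\<^sub>t - \<theta>\<^sub>t\<parallel> + \<parallel>B\<parallel> \<parallel>v\<^sub>t\<^sub>+\<^sub>1 - \<eta>\<^sub>t\<parallel>\<close>.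
  The lower bound on \<open>\<gamma>\<^sub>x\<close> says \<open>\<parallel>A\<parallel> (1 - \<gamma>\<^sub>x\<alpha>\<^sub>x) < 1\<close>, so the errors satisfy linear recursions with
  rate below 1, driven by the variation of the minimizers. Each correction changes the planned
  states and inputs by at most \<open>\<alpha>\<^sub>t\<close> times a diameter, and \<open>\<alpha>\<^sub>t\<close> is at most the length of the projected
  gradient step divided by \<open>\<delta>\<close>; over the \<open>\<mu>\<close> steps until a planned state is reached these changes add
  up to a summable error. Finally the benchmark cannot beat the pointwise minimizers.
\<close>

section \<open>Gradient steps on convex sets\<close>

lemma has_real_derivative_along_segment:
  fixes f :: "'a::real_inner \<Rightarrow> real"
  assumes "convex S" "x \<in> S" "y \<in> S" "s \<in> {0..1}"
    and "(f has_derivative (\<lambda>h. g \<bullet> h)) (at (x + s *\<^sub>R (y - x)) within S)"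
  shows "((\<lambda>s. f (x + s *\<^sub>R (y - x))) has_real_derivative g \<bullet> (y - x)) (at s within {0..1})"
proof -
  have "(\<lambda>s. x + s *\<^sub>R (y - x)) ` {0..1} \<subseteq> S"
  proof clarify
    fix r :: real assume "r \<in> {0..1}"
    then have "(1 - r) *\<^sub>R x + r *\<^sub>R y \<in> S"
      using assms(1-3) by (simp add: convex_alt)
    then show "x + r *\<^sub>R (y - x) \<in> S" by (simp add: algebra_simps)
  qed
  then have "(f has_derivative (\<lambda>h. g \<bullet> h))
      (at (x + s *\<^sub>R (y - x)) within (\<lambda>s. x + s *\<^sub>R (y - x)) ` {0..1})"
    using assms(5) has_derivative_subset by blast
  moreover have "((\<lambda>s. x + s *\<^sub>R (y - x)) has_derivative (\<lambda>h. h *\<^sub>R (y - x))) (at s within {0..1})"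
    by (auto intro!: derivative_eq_intros)
  ultimately have "((\<lambda>s. f (x + s *\<^sub>R (y - x))) has_derivative (\<lambda>h. g \<bullet> (h *\<^sub>R (y - x))))
      (at s within {0..1})"
    using has_derivative_in_compose by blast
  then show ?thesis
    by (simp add: has_field_derivative_def mult.commute[of _ "g \<bullet> (y - x)"] mult_commute_abs)
qed

text \<open>The two functionals agree on the directions \<open>w - x\<close> with
  \<open>w \<in> S\<close>, hence on differences of points of \<open>S\<close>. Since
  \<open>S\<close> contains a ball, a positive multiple of \<open>g - g'\<close> is such a
  difference unless \<open>g = g'\<close>.\<close>

lemma gradient_unique_within_convex:
  fixes f :: "'a::real_inner \<Rightarrow> real"
  assumes S: "convex S" "interior S \<noteq> {}" "x \<in> S"
    and g: "(f has_derivative (\<lambda>h. g \<bullet> h)) (at x within S)"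
    and g': "(f has_derivative (\<lambda>h. g' \<bullet> h)) (at x within S)"
  shows "g = g'"
proof -
  obtain z e where e: "e > 0" "ball z e \<subseteq> S"
    using S(2) by (meson all_not_in_conv mem_interior)
  have eq: "g \<bullet> (w - x) = g' \<bullet> (w - x)" if "w \<in> S" for w
  proof -
    have "((\<lambda>s. f (x + s *\<^sub>R (w - x))) has_real_derivative g \<bullet> (w - x)) (at 0 within {0..1})"
      "((\<lambda>s. f (x + s *\<^sub>R (w - x))) has_real_derivative g' \<bullet> (w - x)) (at 0 within {0..1})"
      using g g' S that by (auto intro!: has_real_derivative_along_segment[where S=S])
    then show ?thesis
      by (rule has_field_derivative_unique) (simp add: trivial_limit_within islimpt_Icc)
  qed
  \<comment> \<open>The \<open>+ 1\<close> avoids a division by zero if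
    \<open>g = g'\<close>.\<close>
  define w where "w = z + (e / 2 / (norm (g - g') + 1)) *\<^sub>R (g - g')"
  have "norm (w - z) < e"
  proof -
    have "norm (w - z) = e / 2 * (norm (g - g') / (norm (g - g') + 1))"
      using e by (simp add: w_def)
    also have "\<dots> \<le> e / 2 * 1"
      using e by (intro mult_left_mono) (auto simp: divide_le_eq add_nonneg_pos)
    finally show ?thesis using e by simp
  qed
  then have "w \<in> S" using e by (auto simp: dist_norm norm_minus_commute)
  moreover have "z \<in> S" using e by auto
  ultimately have "(g - g') \<bullet> (w - z) = 0"
    using eq[of w] eq[of z] by (simp add: algebra_simps)
  then show ?thesis
    using e by (simp add: w_def) (smt (verit) norm_ge_zero)
qed

text \<open>This justifies the \<open>THE\<close> in \<open>gradient_within\<close>: existence is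
  the representation of a linear functional by an inner product, uniqueness the preceding
  lemma.\<close>

lemma has_derivative_gradient_within:
  fixes f :: "'a::euclidean_space \<Rightarrow> real"
  assumes S: "convex S" "interior S \<noteq> {}" "x \<in> S" and f: "f differentiable (at x within S)"
  shows "(f has_derivative (\<lambda>h. gradient_within f S x \<bullet> h)) (at x within S)"
proof -
  obtain f' where f': "(f has_derivative f') (at x within S)"
    using f by (auto simp: differentiable_def)
  then interpret linear f' by (rule has_derivative_linear)
  define g where "g = (\<Sum>b\<in>Basis. f' b *\<^sub>R b)"
  have "f' h = g \<bullet> h" for h
  proof -
    have "f' h = f' (\<Sum>b\<in>Basis. (h \<bullet> b) *\<^sub>R b)"
      by (simp add: euclidean_representation)
    also have "\<dots> = (\<Sum>b\<in>Basis. (h \<bullet> b) * f' b)"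
      by (simp add: sum scale)
    also have "\<dots> = g \<bullet> h"
      by (simp add: g_def inner_sum_left inner_commute[of h] mult.commute)
    finally show ?thesis .
  qed
  then have "f' = (\<lambda>h. g \<bullet> h)" by auto
  with f' have "(f has_derivative (\<lambda>h. g \<bullet> h)) (at x within S)" by simp
  then show ?thesis unfolding gradient_within_def
    by (rule theI) (rule gradient_unique_within_convex[OF S _ \<open>(f has_derivative (\<lambda>h. g \<bullet> h)) (at x within S)\<close>])
qed

text \<open>The defining inequality along the segment is divided by \<open>s\<close>, and
  \<open>s\<close> tends to \<open>0\<close>.\<close>

lemma strongly_convex_on_lower_bound:
  fixes f :: "'a::real_inner \<Rightarrow> real"
  assumes f: "strongly_convex_on \<alpha> S f" and xy: "x \<in> S" "y \<in> S"
    and g: "(f has_derivative (\<lambda>h. g \<bullet> h)) (at x within S)"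
  shows "f x + g \<bullet> (y - x) + \<alpha> / 2 * (norm (y - x))\<^sup>2 \<le> f y"
proof -
  let ?h = "\<lambda>s. f (x + s *\<^sub>R (y - x))"
  have S: "convex S" using f by (simp add: strongly_convex_on_def)
  have "(?h has_real_derivative g \<bullet> (y - x)) (at 0 within {0..1})"
    using g S xy by (auto intro!: has_real_derivative_along_segment[where S=S])
  then have lim: "((\<lambda>s. (?h s - ?h 0) / (s - 0)) \<longlongrightarrow> g \<bullet> (y - x)) (at 0 within {0..1})"
    by (simp add: has_field_derivative_iff)
  have "((\<lambda>s. f y - f x - \<alpha> / 2 * (1 - s) * (norm (y - x))\<^sup>2)
      \<longlongrightarrow> f y - f x - \<alpha> / 2 * (1 - 0) * (norm (y - x))\<^sup>2) (at 0 within {0..1})"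
    by (intro tendsto_intros)
  moreover have "\<forall>\<^sub>F s in at 0 within {0..1}.
      (?h s - ?h 0) / (s - 0) \<le> f y - f x - \<alpha> / 2 * (1 - s) * (norm (y - x))\<^sup>2"
  proof (unfold eventually_at_filter, rule always_eventually, clarify)
    fix s :: real assume s: "s \<noteq> 0" "s \<in> {0..1}"
    have "f ((1 - s) *\<^sub>R x + s *\<^sub>R y)
        \<le> (1 - s) * f x + s * f y - \<alpha> / 2 * s * (1 - s) * (norm (x - y))\<^sup>2"
      using f xy s(2) unfolding strongly_convex_on_def by blast
    moreover have "(1 - s) *\<^sub>R x + s *\<^sub>R y = x + s *\<^sub>R (y - x)" by (simp add: algebra_simps)
    ultimately have "?h s - ?h 0 \<le> s * (f y - f x - \<alpha> / 2 * (1 - s) * (norm (y - x))\<^sup>2)"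
      by (simp add: algebra_simps norm_minus_commute)
    then show "(?h s - ?h 0) / (s - 0) \<le> f y - f x - \<alpha> / 2 * (1 - s) * (norm (y - x))\<^sup>2"
      using s by (simp add: divide_le_eq mult.commute)
  qed
  ultimately have "g \<bullet> (y - x) \<le> f y - f x - \<alpha> / 2 * (1 - 0) * (norm (y - x))\<^sup>2"
    using lim by (intro tendsto_le) (auto simp: trivial_limit_within islimpt_Icc)
  then show ?thesis by simp
qed

lemma smooth_fun_on_upper_bound:
  fixes f :: "'a::euclidean_space \<Rightarrow> real"
  assumes S: "convex S" "interior S \<noteq> {}" and f: "smooth_fun_on l S f" and xy: "x \<in> S" "y \<in> S"
  shows "f y \<le> f x + gradient_within f S x \<bullet> (y - x) + l / 2 * (norm (y - x))\<^sup>2"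
proof -
  let ?g = "gradient_within f S"
  let ?z = "\<lambda>s. x + s *\<^sub>R (y - x)"
  \<comment> \<open>The claim is \<open>?q 1 \<le> ?q 0\<close>. By the mean value theorem it
    suffices that \<open>?q'\<close> is nonpositive, which follows from Cauchy-Schwarz and the
    Lipschitz bound on the gradient.\<close>
  let ?q = "\<lambda>s. f (?z s) - s * (?g x \<bullet> (y - x)) - l / 2 * s\<^sup>2 * (norm (y - x))\<^sup>2"
  let ?q' = "\<lambda>s. (?g (?z s) - ?g x) \<bullet> (y - x) - l * s * (norm (y - x))\<^sup>2"
  have z: "?z s \<in> S" if "s \<in> {0..1}" for s
  proof -
    have "(1 - s) *\<^sub>R x + s *\<^sub>R y \<in> S"
      using S(1) xy that by (simp add: convex_alt)
    then show ?thesis by (simp add: algebra_simps)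
  qed
  have "(?q has_real_derivative ?q' s) (at s within {0..1})" if s: "s \<in> {0..1}" for s
  proof -
    have "((\<lambda>s. f (?z s)) has_real_derivative ?g (?z s) \<bullet> (y - x)) (at s within {0..1})"
      using f S xy s z[OF s] unfolding smooth_fun_on_def
      by (intro has_real_derivative_along_segment[where S=S] has_derivative_gradient_within) auto
    then show ?thesis
      by (auto intro!: derivative_eq_intros simp: algebra_simps)
  qed
  then have "(?q has_derivative (\<lambda>h. ?q' s * h)) (at s within {0..1})" if "0 \<le> s" "s \<le> 1" for s
    using that by (auto simp: has_field_derivative_def mult_commute_abs)
  from mvt_simple[of 0 1 ?q "\<lambda>s h. ?q' s * h", OF _ this]
  obtain s where s: "s \<in> {0<..<1}" "?q 1 - ?q 0 = ?q' s"
    by auto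
  have "(?g (?z s) - ?g x) \<bullet> (y - x) \<le> norm (?g (?z s) - ?g x) * norm (y - x)"
    by (rule norm_cauchy_schwarz)
  also have "\<dots> \<le> l * norm (?z s - x) * norm (y - x)"
    using f xy(1) z[of s] s(1) unfolding smooth_fun_on_def dist_norm[symmetric]
    by (intro mult_right_mono) (auto intro!: lipschitz_onD simp del: dist_add_cancel2)
  also have "\<dots> = l * s * (norm (y - x))\<^sup>2"
    using s(1) by (simp add: power2_eq_square)
  finally show ?thesis using s(2) by simp
qed

text \<open>The bounds are evaluated at \<open>m + w\<close> and \<open>m - w\<close>, where \<open>m\<close> is the midpoint of \<open>x, y\<close> and
  \<open>w\<close> has length \<open>\<parallel>x - y\<parallel> / 2\<close> and the direction of \<open>b - a\<close>.\<close>

lemma gradient_diff_le_if_quadratic_bounds: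
  fixes \<psi> :: "'a::real_inner \<Rightarrow> real"
  assumes xy: "x \<noteq> y"
    and a: "\<And>z. dist z (midpoint x y) \<le> dist x y / 2 \<Longrightarrow> \<bar>\<psi> z - \<psi> x - a \<bullet> (z - x)\<bar> \<le> c / 2 * (norm (z - x))\<^sup>2"
    and b: "\<And>z. dist z (midpoint x y) \<le> dist x y / 2 \<Longrightarrow> \<bar>\<psi> z - \<psi> y - b \<bullet> (z - y)\<bar> \<le> c / 2 * (norm (z - y))\<^sup>2"
  shows "norm (b - a) \<le> c * norm (x - y)"
\<comment> \<open>For \<open>b = a\<close> there is no direction for \<open>w\<close>. Then only
  \<open>0 \<le> c\<close> is left to show, by the first bound at \<open>z = y\<close>.\<close>
proof (cases "b = a")
  case True
  have "0 \<le> \<bar>\<psi> y - \<psi> x - a \<bullet> (y - x)\<bar>" by simp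
  also have "\<dots> \<le> c / 2 * (norm (y - x))\<^sup>2"
    by (rule a) (simp add: dist_midpoint)
  finally have "0 \<le> c" using xy by (simp add: zero_le_mult_iff zero_le_divide_iff)
  then show ?thesis using True by simp
next
  case False
  define m where "m = midpoint x y"
  define w where "w = (norm (x - y) / (2 * norm (b - a))) *\<^sub>R (b - a)"
  have nw: "norm w = norm (x - y) / 2" using False by (simp add: w_def)
  have bw: "(b - a) \<bullet> w = norm (b - a) * norm (x - y) / 2"
    using False by (simp add: w_def dot_square_norm power2_eq_square)
  have z: "dist (m + w) (midpoint x y) \<le> dist x y / 2" "dist (m - w) (midpoint x y) \<le> dist x y / 2"
    using nw by (auto simp: m_def dist_norm)
  \<comment> \<open>Both points lie on the sphere with diameter from \<open>x\<close> to
    \<open>y\<close>, so they see it under a right angle (Thales) and Pythagoras applies.\<close>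
  have sq: "(norm (m + w - x))\<^sup>2 + (norm (m + w - y))\<^sup>2 = (norm (x - y))\<^sup>2"
    "(norm (m - w - x))\<^sup>2 + (norm (m - w - y))\<^sup>2 = (norm (x - y))\<^sup>2"
  proof -
    define d where "d = (1/2) *\<^sub>R (x - y)"
    have e: "m + w - x = w - d" "m + w - y = w + d" "m - w - x = - (w + d)" "m - w - y = - (w - d)"
      by (auto simp: m_def d_def midpoint_def algebra_simps simp flip: scaleR_add_left)
    have nd: "norm (x - y) = 2 * norm d" by (simp add: d_def)
    have "w \<bullet> w = d \<bullet> d" using nw nd by (simp add: norm_eq_sqrt_inner)
    then show "(norm (m + w - x))\<^sup>2 + (norm (m + w - y))\<^sup>2 = (norm (x - y))\<^sup>2"
      "(norm (m - w - x))\<^sup>2 + (norm (m - w - y))\<^sup>2 = (norm (x - y))\<^sup>2"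
      unfolding e nd norm_minus_cancel power_mult_distrib
      by (auto simp: power2_norm_eq_inner algebra_simps)
  qed
  have "\<psi> y - \<psi> x + b \<bullet> (m + w - y) - a \<bullet> (m + w - x) \<le> c / 2 * (norm (x - y))\<^sup>2"
    using a[OF z(1)] b[OF z(1)] unfolding sq(1)[symmetric] distrib_left abs_le_iff by linarith
  moreover have "\<psi> x - \<psi> y + a \<bullet> (m - w - x) - b \<bullet> (m - w - y) \<le> c / 2 * (norm (x - y))\<^sup>2"
    using a[OF z(2)] b[OF z(2)] unfolding sq(2)[symmetric] distrib_left abs_le_iff by linarith
  \<comment> \<open>Each of the two inequalities has eliminated the value of \<psi> at one test
    point. In their sum \<psi> at \<open>x\<close> and at \<open>y\<close> cancels too.\<close>
  ultimately have "2 * ((b - a) \<bullet> w) \<le> c * (norm (x - y))\<^sup>2"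
    by (simp add: algebra_simps)
  then have *: "norm (b - a) * norm (x - y) \<le> (c * norm (x - y)) * norm (x - y)"
    by (simp add: bw power2_eq_square)
  then show ?thesis using xy by simp
qed

text \<open>The segment is compact in an open set, so it keeps a positive margin \<open>e\<close>.
  Cut into pieces shorter than \<open>e\<close>, each piece has its diameter ball inside
  \<open>S\<close>, and the local bounds telescope.\<close>

lemma norm_image_diff_le_if_on_diameter_balls:
  fixes \<Phi> :: "'a::euclidean_space \<Rightarrow> 'b::real_normed_vector"
  assumes S: "open S" "convex S" and xy: "x \<in> S" "y \<in> S"
    and loc: "\<And>p q. p \<noteq> q \<Longrightarrow> cball (midpoint p q) (dist p q / 2) \<subseteq> S \<Longrightarrow> norm (\<Phi> p - \<Phi> q) \<le> c * norm (p - q)"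
  shows "norm (\<Phi> x - \<Phi> y) \<le> c * norm (x - y)"
proof (cases "x = y")
  case False
  have "compact (closed_segment x y)" "closed_segment x y \<subseteq> S"
    using S xy by (auto simp: closed_segment_subset)
  then obtain e where e: "e > 0" "(\<Union>z\<in>closed_segment x y. cball z e) \<subseteq> S"
    using S(1) compact_subset_open_imp_cball_epsilon_subset by metis
  obtain N :: nat where N: "dist x y / e < real N"
    using reals_Archimedean2 by blast
  moreover have "0 \<le> dist x y / e" using e by simp
  ultimately have N0: "N > 0" by linarith
  define p where "p i = x + (real i / real N) *\<^sub>R (y - x)" for i
  have diff: "p (Suc i) - p i = (1 / real N) *\<^sub>R (y - x)" for i
    by (simp add: p_def add_divide_distrib flip: scaleR_diff_left)
  have step: "norm (\<Phi> (p (Suc i)) - \<Phi> (p i)) \<le> c * norm (x - y) / real N" if i: "i < N" for i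
  proof -
    have pin: "p j \<in> closed_segment x y" if "j \<le> N" for j
      unfolding in_segment using that N0
      by (intro exI[of _ "real j / real N"]) (auto simp: p_def algebra_simps)
    have half: "r / 2 \<le> e" if "0 \<le> r" "r \<le> e" for r :: real using that by linarith
    have "dist (p (Suc i)) (p i) = dist x y / real N"
      using N0 by (simp add: dist_norm diff norm_minus_commute)
    moreover have "midpoint (p (Suc i)) (p i) \<in> closed_segment x y"
      using pin[of i] pin[of "Suc i"] i convex_contains_segment[of "closed_segment x y"] midpoint_in_closed_segment
      by (metis Suc_leI convex_closed_segment less_imp_le_nat subset_iff)
    moreover have "dist x y / real N / 2 \<le> e"
    proof -
      have "dist x y / real N \<le> e" using N e N0 by (simp add: field_simps)
      moreover have "0 \<le> dist x y / real N" by simp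
      ultimately show ?thesis using half \<open>dist x y / real N \<le> e\<close> by blast
    qed
    ultimately have "cball (midpoint (p (Suc i)) (p i)) (dist (p (Suc i)) (p i) / 2) \<subseteq> S"
      using e(2) by (fastforce)
    moreover have "p (Suc i) \<noteq> p i" using diff[of i] False N0 by auto
    ultimately have "norm (\<Phi> (p (Suc i)) - \<Phi> (p i)) \<le> c * norm (p (Suc i) - p i)"
      by (intro loc)
    then show ?thesis by (simp add: diff norm_minus_commute)
  qed
  have "norm (\<Phi> y - \<Phi> x) = norm (\<Sum>i<N. \<Phi> (p (Suc i)) - \<Phi> (p i))"
    using N0 by (subst sum_lessThan_telescope) (simp add: p_def)
  also have "\<dots> \<le> (\<Sum>i<N. c * norm (x - y) / real N)"
    using step by (intro sum_norm_le) auto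
  also have "\<dots> = c * norm (x - y)" using N0 by simp
  finally show ?thesis by (simp add: norm_minus_commute)
qed simp

text \<open>Carries a Lipschitz estimate from the interior to boundary points, by limits of
  sequences.\<close>

lemma norm_image_diff_le_on_closure:
  fixes \<Phi> :: "'a::metric_space \<Rightarrow> 'b::real_normed_vector"
  assumes "continuous_on S \<Phi>" "I \<subseteq> S" "S \<subseteq> closure I" "x \<in> S" "y \<in> S"
    and le: "\<And>p q. p \<in> I \<Longrightarrow> q \<in> I \<Longrightarrow> norm (\<Phi> p - \<Phi> q) \<le> c * dist p q"
  shows "norm (\<Phi> x - \<Phi> y) \<le> c * dist x y"
proof -
  obtain p where p: "\<And>n. p n \<in> I" "p \<longlonglongrightarrow> x"
    using assms(3,4) by (metis closure_sequential subsetD)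
  obtain q where q: "\<And>n. q n \<in> I" "q \<longlonglongrightarrow> y"
    using assms(3,5) by (metis closure_sequential subsetD)
  have "(\<lambda>n. \<Phi> (p n)) \<longlonglongrightarrow> \<Phi> x" "(\<lambda>n. \<Phi> (q n)) \<longlonglongrightarrow> \<Phi> y"
    using assms(1,2,4,5) p q unfolding continuous_on_sequentially by (auto simp: o_def subset_iff)
  then have "(\<lambda>n. norm (\<Phi> (p n) - \<Phi> (q n))) \<longlonglongrightarrow> norm (\<Phi> x - \<Phi> y)"
    "(\<lambda>n. c * dist (p n) (q n)) \<longlonglongrightarrow> c * dist x y"
    using p q by (auto intro!: tendsto_intros)
  then show ?thesis
    using le[OF p(1) q(1)] by (intro LIMSEQ_le) auto
qed

text \<open>The map \<open>?\<Phi>\<close> is the gradient of \<open>?\<psi>\<close>. Strong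
  convexity and smoothness of \<open>f\<close> bound the first-order error of \<open>?\<psi>\<close>
  from above and below by the same quadratic term with constant
  \<open>1 - \<gamma> * \<alpha>\<close>, and such a two-sided bound makes the gradient Lipschitz
  with this constant.\<close>

lemma gradient_step_contraction:
  fixes f :: "'a::euclidean_space \<Rightarrow> real"
  assumes S: "convex S" "interior S \<noteq> {}"
    and f: "strongly_convex_on \<alpha> S f" "smooth_fun_on l S f"
    and \<gamma>: "0 \<le> \<gamma>" "\<gamma> * (l + \<alpha>) \<le> 2"
    and xy: "x \<in> S" "y \<in> S"
  shows "norm ((x - \<gamma> *\<^sub>R gradient_within f S x) - (y - \<gamma> *\<^sub>R gradient_within f S y))
    \<le> (1 - \<gamma> * \<alpha>) * norm (x - y)"
proof -
  let ?g = "gradient_within f S"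
  let ?\<Phi> = "\<lambda>x. x - \<gamma> *\<^sub>R ?g x"
  let ?\<psi> = "\<lambda>x. (norm x)\<^sup>2 / 2 - \<gamma> * f x"
  have quad: "\<bar>?\<psi> z - ?\<psi> p - ?\<Phi> p \<bullet> (z - p)\<bar> \<le> (1 - \<gamma> * \<alpha>) / 2 * (norm (z - p))\<^sup>2"
    if "z \<in> S" "p \<in> S" for z p
  proof -
    define d where "d = f z - f p - ?g p \<bullet> (z - p)"
    define N where "N = (norm (z - p))\<^sup>2"
    have "N \<ge> 0" by (simp add: N_def)
    have "(f has_derivative (\<lambda>h. ?g p \<bullet> h)) (at p within S)"
      using f(2) S that by (auto simp: smooth_fun_on_def intro: has_derivative_gradient_within)
    then have "\<alpha> / 2 * N \<le> d" "d \<le> l / 2 * N"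
      using strongly_convex_on_lower_bound[OF f(1) that(2,1)] smooth_fun_on_upper_bound[OF S f(2) that(2,1)]
      unfolding d_def N_def by fastforce+
    from this[THEN mult_left_mono, OF \<gamma>(1)]
    have "\<gamma> * (\<alpha> / 2 * N) \<le> \<gamma> * d" "\<gamma> * d \<le> \<gamma> * (l / 2 * N)"
      .
    \<comment> \<open>Only the lower bound on \<open>N / 2 - \<gamma> * d\<close> uses the step
      size: smoothness gives the factor \<open>\<gamma> * l - 1\<close>, which is at most
      \<open>1 - \<gamma> * \<alpha>\<close>.\<close>
    moreover have "(\<gamma> * (l + \<alpha>)) * N \<le> 2 * N"
      using \<gamma>(2) \<open>N \<ge> 0\<close> by (rule mult_right_mono)
    ultimately have "\<bar>N / 2 - \<gamma> * d\<bar> \<le> (1 - \<gamma> * \<alpha>) / 2 * N"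
      by (simp add: abs_le_iff field_simps)
    moreover have "?\<psi> z - ?\<psi> p - ?\<Phi> p \<bullet> (z - p) = N / 2 - \<gamma> * d"
    proof -
      have "N = (norm z)\<^sup>2 - 2 * (p \<bullet> z) + (norm p)\<^sup>2"
        by (simp add: N_def power2_norm_eq_inner algebra_simps inner_commute)
      moreover have "?\<Phi> p \<bullet> (z - p) = p \<bullet> z - (norm p)\<^sup>2 - \<gamma> * (?g p \<bullet> (z - p))"
        by (simp only: inner_diff_left inner_diff_right[of p] inner_scaleR_left power2_norm_eq_inner)
      moreover have "\<gamma> * d = \<gamma> * f z - \<gamma> * f p - \<gamma> * (?g p \<bullet> (z - p))"
        by (simp only: d_def right_diff_distrib)
      ultimately show ?thesis by linarith
    qed
    ultimately show ?thesis by (simp add: N_def)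
  qed
  have loc: "norm (?\<Phi> p - ?\<Phi> q) \<le> (1 - \<gamma> * \<alpha>) * norm (p - q)"
    if "p \<noteq> q" and ball: "cball (midpoint p q) (dist p q / 2) \<subseteq> interior S" for p q
  proof -
    have sub: "z \<in> S" if "dist z (midpoint p q) \<le> dist p q / 2" for z
    proof -
      have "z \<in> cball (midpoint p q) (dist p q / 2)" using that by (simp add: dist_commute)
      then show ?thesis using ball interior_subset[of S] by auto
    qed
    from sub[of p] sub[of q] have "p \<in> S" "q \<in> S" by (simp_all add: dist_midpoint)
    have "norm (?\<Phi> q - ?\<Phi> p) \<le> (1 - \<gamma> * \<alpha>) * norm (p - q)"
      using \<open>p \<noteq> q\<close>
    proof (rule gradient_diff_le_if_quadratic_bounds[where \<psi> = ?\<psi>])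
      fix z assume "dist z (midpoint p q) \<le> dist p q / 2"
      then have "z \<in> S" by (rule sub)
      then show "\<bar>?\<psi> z - ?\<psi> p - ?\<Phi> p \<bullet> (z - p)\<bar> \<le> (1 - \<gamma> * \<alpha>) / 2 * (norm (z - p))\<^sup>2"
        "\<bar>?\<psi> z - ?\<psi> q - ?\<Phi> q \<bullet> (z - q)\<bar> \<le> (1 - \<gamma> * \<alpha>) / 2 * (norm (z - q))\<^sup>2"
        using quad \<open>p \<in> S\<close> \<open>q \<in> S\<close> by blast+
    qed
    then show ?thesis by (simp only: norm_minus_commute[of "?\<Phi> p" "?\<Phi> q"])
  qed
  have "continuous_on S ?g"
    using f(2) lipschitz_on_continuous_on unfolding smooth_fun_on_def by blast
  then have "continuous_on S ?\<Phi>" by (intro continuous_intros)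
  then have "norm (?\<Phi> x - ?\<Phi> y) \<le> (1 - \<gamma> * \<alpha>) * dist x y"
  proof (rule norm_image_diff_le_on_closure[OF _ interior_subset _ xy])
    show "S \<subseteq> closure (interior S)" using S by (simp add: convex_closure_interior closure_subset)
    show "norm (?\<Phi> p - ?\<Phi> q) \<le> (1 - \<gamma> * \<alpha>) * dist p q"
      if "p \<in> interior S" "q \<in> interior S" for p q
      unfolding dist_norm
      using open_interior convex_interior[OF S(1)] that loc
      by (rule norm_image_diff_le_if_on_diameter_balls)
  qed
  then show ?thesis by (simp only: dist_norm)
qed

text \<open>An open nonempty set has two distinct points. At these the contraction bounds a norm by
  \<open>1 - \<gamma> * \<alpha>\<close> times a positive number.\<close>

lemma contraction_factor_nonneg:
  fixes f :: "'a::euclidean_space \<Rightarrow> real"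
  assumes "convex S" "interior S \<noteq> {}"
    and "strongly_convex_on \<alpha> S f" "smooth_fun_on l S f" "0 \<le> \<gamma>" "\<gamma> * (l + \<alpha>) \<le> 2"
  shows "0 \<le> 1 - \<gamma> * \<alpha>"
proof -
  obtain x where x: "x \<in> interior S" using assms(2) by blast
  moreover have "interior S \<noteq> {x}" using not_open_singleton open_interior by metis
  ultimately obtain y where "y \<in> interior S" "y \<noteq> x" by blast
  with x have "x \<in> S" "y \<in> S" "0 < norm (x - y)" using interior_subset by auto
  moreover from this have "0 \<le> (1 - \<gamma> * \<alpha>) * norm (x - y)"
    by (intro order_trans[OF norm_ge_zero gradient_step_contraction[OF assms]])
  ultimately show ?thesis by (simp add: zero_le_mult_iff)
qed

section \<open>First-order optimality and existence of minimizers\<close>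

lemma first_order_minimizer:
  fixes f :: "'a::real_inner \<Rightarrow> real"
  assumes "convex S" "x \<in> S" "(f has_derivative (\<lambda>h. g \<bullet> h)) (at x within S)"
    and min: "\<And>z. z \<in> S \<Longrightarrow> f x \<le> f z" and "y \<in> S"
  shows "0 \<le> g \<bullet> (y - x)"
proof -
  let ?h = "\<lambda>s. f (x + s *\<^sub>R (y - x))"
  have "(?h has_real_derivative g \<bullet> (y - x)) (at 0 within {0..1})"
    using assms by (auto intro!: has_real_derivative_along_segment[where S=S])
  then have lim: "((\<lambda>s. (?h s - ?h 0) / (s - 0)) \<longlongrightarrow> g \<bullet> (y - x)) (at 0 within {0..1})"
    by (simp add: has_field_derivative_iff)
  have "\<forall>\<^sub>F s in at 0 within {0..1}. 0 \<le> (?h s - ?h 0) / (s - 0)"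
  proof (unfold eventually_at_filter, rule always_eventually, clarify)
    fix s :: real assume s: "s \<noteq> 0" "s \<in> {0..1}"
    have "(1 - s) *\<^sub>R x + s *\<^sub>R y \<in> S"
      using assms s by (simp add: convex_alt)
    then have "?h 0 \<le> ?h s" using min by (simp add: algebra_simps)
    then show "0 \<le> (?h s - ?h 0) / (s - 0)" using s by simp
  qed
  then show ?thesis
    using lim by (intro tendsto_lowerbound) (auto simp: trivial_limit_within islimpt_Icc)
qed

text \<open>A constrained minimizer is a fixed point of the projected gradient step even if it lies
  on the boundary with a nonzero gradient. This is the situation of the input costs.\<close>

lemma closest_point_gradient_step_minimizer:
  fixes f :: "'a::euclidean_space \<Rightarrow> real"
  assumes "convex S" "closed S" "x \<in> S" "(f has_derivative (\<lambda>h. g \<bullet> h)) (at x within S)"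
    and "\<And>z. z \<in> S \<Longrightarrow> f x \<le> f z" and "0 \<le> \<gamma>"
  shows "closest_point S (x - \<gamma> *\<^sub>R g) = x"
proof (rule closest_point_unique[symmetric])
  show "\<forall>z\<in>S. dist (x - \<gamma> *\<^sub>R g) x \<le> dist (x - \<gamma> *\<^sub>R g) z"
  proof
    fix z assume "z \<in> S"
    then have "0 \<le> g \<bullet> (z - x)" using assms by (intro first_order_minimizer[where S=S]) auto
    then have "0 \<le> 2 * \<gamma> * (g \<bullet> (z - x)) + (z - x) \<bullet> (z - x)" using \<open>0 \<le> \<gamma>\<close> by simp
    also have "\<dots> = (x - \<gamma> *\<^sub>R g - z) \<bullet> (x - \<gamma> *\<^sub>R g - z) - (x - \<gamma> *\<^sub>R g - x) \<bullet> (x - \<gamma> *\<^sub>R g - x)"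
      by (simp add: algebra_simps inner_commute)
    finally show "dist (x - \<gamma> *\<^sub>R g) x \<le> dist (x - \<gamma> *\<^sub>R g) z"
      unfolding dist_norm norm_le by simp
  qed
qed (use assms in auto)

text \<open>\<open>arg_min_on\<close> is a choice operator, so existence of a minimizer must come
  first.\<close>

lemma arg_min_on_attained:
  fixes f :: "'a::topological_space \<Rightarrow> real"
  assumes "compact S" "S \<noteq> {}" "continuous_on S f"
  shows "arg_min_on f S \<in> S" and "z \<in> S \<Longrightarrow> f (arg_min_on f S) \<le> f z"
proof -
  have "\<exists>x. is_arg_min f (\<lambda>x. x \<in> S) x"
    using continuous_attains_inf[OF assms] by (auto simp: is_arg_min_linorder)
  then have "is_arg_min f (\<lambda>x. x \<in> S) (arg_min_on f S)"
    unfolding arg_min_on_def arg_min_def by (rule someI_ex)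
  then show "arg_min_on f S \<in> S" and "z \<in> S \<Longrightarrow> f (arg_min_on f S) \<le> f z"
    by (auto simp: is_arg_min_linorder)
qed

section \<open>One step of the algorithm\<close>

lemma state_cong:
  assumes "\<And>i. i \<in> {1..k} \<Longrightarrow> us i = ws i"
  shows "state A B x us k = state A B x ws k"
  using assms by (induction k) auto

lemma state_shift: "state A B (A *v x + B *v us 1) (\<lambda>i. us (i + 1)) k = state A B x us (Suc k)"
  by (induction k) auto

lemma state_convex_combination:
  "state A B x (\<lambda>i. (1 - a) *\<^sub>R us i + a *\<^sub>R ws i) k
    = (1 - a) *\<^sub>R state A B x us k + a *\<^sub>R state A B x ws k"
proof (induction k)
  case (Suc k)
  then show ?case
    by (simp only: state.simps matrix_vector_right_distrib matrix_vector_mult_scaleR)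
      (simp add: scaleR_add_right)
qed (simp add: algebra_simps)

text \<open>Abstracts from the inequalities of the polytopes: \<open>X\<close> and \<open>U\<close>
  are convex bodies, and \<open>Xbar\<close> consists of the points whose closed \<delta>-ball lies
  in \<open>X\<close>.\<close>

locale constrained_system =
  fixes A :: "real^'n^'n" and B :: "real^'m^'n"
    and X Xbar :: "(real^'n) set" and U :: "(real^'m) set" and \<delta> :: real and \<mu> :: nat
  assumes X: "convex X" "compact X" "interior X \<noteq> {}"
    and U: "convex U" "compact U" "interior U \<noteq> {}"
    and delta_pos: "\<delta> > 0"
    and Xbar_eq: "Xbar = {x. \<forall>r. norm r \<le> 1 \<longrightarrow> x + \<delta> *\<^sub>R r \<in> X}"
    and steering: "\<And>x y. x \<in> X \<Longrightarrow> y \<in> X \<Longrightarrow>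
      \<exists>us. feasible_from A B X U \<mu> x us \<and> predicted A B \<mu> x us = y"
begin

lemma Xbar_subset: "Xbar \<subseteq> X"
proof
  fix x assume "x \<in> Xbar"
  then have "x + \<delta> *\<^sub>R 0 \<in> X" unfolding Xbar_eq by (metis (mono_tags, lifting) mem_Collect_eq norm_zero zero_le_one)
  then show "x \<in> X" by simp
qed

text \<open>As an intersection of translates of \<open>X\<close>, the set \<open>Xbar\<close>
  inherits closedness and convexity.\<close>

lemma Xbar_eq_Inter: "Xbar = (\<Inter>r\<in>cball 0 1. (+) (- \<delta> *\<^sub>R r) ` X)"
proof -
  have "x \<in> (+) (- \<delta> *\<^sub>R r) ` X \<longleftrightarrow> x + \<delta> *\<^sub>R r \<in> X" for x r
    by (auto simp: image_iff algebra_simps)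
  then show ?thesis unfolding Xbar_eq by auto
qed

lemma closed_Xbar: "closed Xbar"
  unfolding Xbar_eq_Inter using X(2) by (intro closed_INT ballI closed_translation compact_imp_closed)

lemma convex_Xbar: "convex Xbar"
  unfolding Xbar_eq_Inter using X(1) by (intro convex_INT convex_translation)

text \<open>For \<open>\<mu> = 0\<close> the steering property would identify all points of
  \<open>X\<close>, but a singleton has empty interior.\<close>

lemma mu_pos: "\<mu> > 0"
proof (rule ccontr)
  assume "\<not> \<mu> > 0"
  then have eq: "x = y" if "x \<in> X" "y \<in> X" for x y
    using steering[OF that] by (auto simp: predicted_eq_state)
  obtain x where "x \<in> X" using X(3) interior_subset by fastforce
  then have "X = {x}" using eq by blast
  then show False using X(3) by simp
qed

lemma dist_X_le: "x \<in> X \<Longrightarrow> y \<in> X \<Longrightarrow> dist x y \<le> diameter X"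
  using X(2) compact_imp_bounded diameter_bounded_bound by blast

lemma dist_U_le: "x \<in> U \<Longrightarrow> y \<in> U \<Longrightarrow> dist x y \<le> diameter U"
  using U(2) compact_imp_bounded diameter_bounded_bound by blast

lemma diameters_nonneg: "0 \<le> diameter X" "0 \<le> diameter U"
  using X(2) U(2) by (auto intro!: diameter_ge_0 compact_imp_bounded)

lemma state_feasible_in_X:
  assumes "x \<in> X" "feasible_from A B X U \<mu> x us" "k \<le> \<mu>"
  shows "state A B x us k \<in> X"
  using assms by (cases "k = 0") (auto simp: feasible_from_def)

text \<open>States are affine in the inputs, so convexity of \<open>X\<close> and \<open>U\<close>
  passes to the combination. The final state of \<open>us\<close> is exempt, as a predicted state
  may leave \<open>X\<close>; hence \<open>final\<close> is a separate premise.\<close>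

lemma feasible_from_convex_combination:
  assumes x: "x \<in> X" and a: "0 \<le> a" "a \<le> 1"
    and g: "feasible_from A B X U \<mu> x g"
    and us: "\<And>i. i \<in> {1..\<mu>} \<Longrightarrow> us i \<in> U" "\<And>k. k < \<mu> \<Longrightarrow> state A B x us k \<in> X"
    and ws: "\<And>i. i \<in> {1..\<mu>} \<Longrightarrow> ws i = (1 - a) *\<^sub>R us i + a *\<^sub>R g i"
    and final: "state A B x ws \<mu> \<in> X"
  shows "feasible_from A B X U \<mu> x ws"
    and "\<And>k. k < \<mu> \<Longrightarrow> dist (state A B x ws k) (state A B x us k) \<le> a * diameter X"
    and "\<And>i. i \<in> {1..\<mu>} \<Longrightarrow> dist (ws i) (us i) \<le> a * diameter U"
proof -
  have st: "state A B x ws k = (1 - a) *\<^sub>R state A B x us k + a *\<^sub>R state A B x g k" if "k \<le> \<mu>" for k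
    unfolding state_convex_combination[symmetric] using ws that by (intro state_cong) auto
  have comb: "dist ((1 - a) *\<^sub>R p + a *\<^sub>R q) p = a * dist q p" for p q :: "'z::real_normed_vector"
  proof -
    have "(1 - a) *\<^sub>R p + a *\<^sub>R q - p = a *\<^sub>R (q - p)" by (simp add: algebra_simps)
    then show ?thesis using a by (simp add: dist_norm)
  qed
  have gX: "state A B x g k \<in> X" if "k \<le> \<mu>" for k
    using x g that by (rule state_feasible_in_X)
  have gU: "g i \<in> U" if "i \<in> {1..\<mu>}" for i
    using g that by (auto simp: feasible_from_def)
  show "feasible_from A B X U \<mu> x ws" unfolding feasible_from_def
  proof (intro conjI ballI)
    show "ws i \<in> U" if "i \<in> {1..\<mu>}" for i
      using ws[OF that] us(1)[OF that] gU[OF that] U(1) a by (simp add: convex_alt)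
    show "state A B x ws k \<in> X" if "k \<in> {1..\<mu>}" for k
    proof (cases "k < \<mu>")
      case True
      then show ?thesis using st[of k] us(2)[of k] gX[of k] X(1) a by (simp add: convex_alt)
    qed (use that final in auto)
  qed
  show "dist (state A B x ws k) (state A B x us k) \<le> a * diameter X" if "k < \<mu>" for k
    using st[of k] us(2)[of k] gX[of k] a that by (simp add: comb mult_left_mono dist_X_le)
  show "dist (ws i) (us i) \<le> a * diameter U" if "i \<in> {1..\<mu>}" for i
    using ws[OF that] us(1)[OF that] gU[OF that] a by (simp add: comb mult_left_mono dist_U_le)
qed

text \<open>Summarizes an iteration without the case distinction and without \<open>g\<close>. Since
  \<open>xt\<close> results from the first input of the plan \<open>up\<close>, the shifted plan
  repeats the old trajectory up to its last step, and the correction deviates from it by at most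
  \<open>a\<close> times a diameter.\<close>

lemma algorithm_step_properties:
  fixes xp up
  defines "xt \<equiv> A *v xp + B *v up 1"
  assumes xp: "xp \<in> X" "feasible_from A B X U \<mu> xp up" and Xbar_ne: "Xbar \<noteq> {}"
    and step: "algorithm_step A B X U Xbar D \<delta> \<mu> \<gamma>x \<gamma>u fxp fup xt vp up vt ut"
  obtains a xh where
    "vt = closest_point U (vp - \<gamma>u *\<^sub>R gradient_within fup U vp)"
    "xh = A *v predicted A B \<mu> xp up + B *v vt" "xh \<in> D"
    "predicted A B \<mu> xt ut = closest_point Xbar (xh - \<gamma>x *\<^sub>R gradient_within fxp D xh)"
    "0 \<le> a" "a \<le> norm (xh - predicted A B \<mu> xt ut) / \<delta>"
    "feasible_from A B X U \<mu> xt ut"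
    "\<And>k. k < \<mu> \<Longrightarrow> dist (state A B xt ut k) (state A B xp up (Suc k)) \<le> a * diameter X"
    "\<And>i. i \<in> {1..\<mu>} \<Longrightarrow> dist (ut i) (if i < \<mu> then up (i + 1) else vt) \<le> a * diameter U"
proof -
  define vh where "vh = (\<lambda>i. if i < \<mu> then up (i + 1) else vt)"
  define xh where "xh = predicted A B \<mu> xt vh"
  define xq where "xq = closest_point Xbar (xh - \<gamma>x *\<^sub>R gradient_within fxp D xh)"
  define e where "e = norm (xh - xq)"
  define db where "db = \<delta> / e"
  define y where "y = xq + db *\<^sub>R (xq - xh)"
  have vt: "vt = closest_point U (vp - \<gamma>u *\<^sub>R gradient_within fup U vp)" and "xh \<in> D"
    using step by (auto simp: algorithm_step_def Let_def xh_def vh_def)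
  have "U \<noteq> {}" using U(3) by auto
  then have "vt \<in> U" unfolding vt using U(2) by (intro closest_point_in_set compact_imp_closed)
  have xq: "xq \<in> Xbar" unfolding xq_def using closed_Xbar Xbar_ne by (rule closest_point_in_set)
  have shift: "state A B xt vh k = state A B xp up (Suc k)" if "k < \<mu>" for k
    unfolding state_shift[symmetric] xt_def using that by (intro state_cong) (auto simp: vh_def)
  have xt: "xt \<in> X" using shift[of 0] mu_pos xp state_feasible_in_X[of xp up "Suc 0"] by simp
  \<comment> \<open>The shifted plan passes through the old final state one step before its end, and
    its last input is \<open>vt\<close>.\<close>
  have xh: "xh = A *v predicted A B \<mu> xp up + B *v vt"
  proof -
    obtain m where m: "\<mu> = Suc m" using mu_pos gr0_implies_Suc by auto
    then show ?thesis using shift[of m] by (simp add: xh_def predicted_eq_state vh_def)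
  qed
  \<comment> \<open>Both branches of the algorithm are brought to one form; no correction is the
    case \<open>a = 0\<close> with an arbitrary feasible \<open>g\<close>.\<close>
  have "\<exists>a g. feasible_from A B X U \<mu> xt g \<and> 0 \<le> a \<and> a \<le> 1 \<and> a \<le> e / \<delta> \<and>
      (\<forall>i\<in>{1..\<mu>}. ut i = (1 - a) *\<^sub>R vh i + a *\<^sub>R g i) \<and>
      (1 - a) *\<^sub>R xh + a *\<^sub>R predicted A B \<mu> xt g = xq"
  proof (cases "e = 0")
    case True
    then have "\<forall>i\<in>{1..\<mu>}. ut i = vh i"
      using step by (auto simp: algorithm_step_def Let_def xh_def vh_def xq_def e_def)
    moreover have "xh = xq" using True by (simp add: e_def)
    moreover obtain g where "feasible_from A B X U \<mu> xt g" using steering[OF xt xt] by blast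
    ultimately show ?thesis using True by (intro exI[of _ 0] exI[of _ g]) simp
  next
    case False
    define a where "a = 1 / (1 + db)"
    have e: "e > 0" using False by (simp add: e_def)
    then have db: "db > 0" using delta_pos by (simp add: db_def)
    \<comment> \<open>The target \<open>y\<close> lies at distance \<delta> from \<open>xq\<close>,
      beyond it as seen from \<open>xh\<close>. As \<open>xq \<in> Xbar\<close>, it belongs to
      \<open>X\<close>, so the steering problem is solvable.\<close>
    have "norm ((1 / e) *\<^sub>R (xq - xh)) \<le> 1" using e by (simp add: e_def norm_minus_commute)
    then have "xq + \<delta> *\<^sub>R ((1 / e) *\<^sub>R (xq - xh)) \<in> X" using xq unfolding Xbar_eq by blast
    then have "y \<in> X" by (simp add: y_def db_def)
    from steering[OF xt this] obtain g' where
      g': "feasible_from A B X U \<mu> xt g'" "predicted A B \<mu> xt g' = y" by blast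
    have "\<exists>g. ((\<exists>g'. feasible_from A B X U \<mu> xt g' \<and> predicted A B \<mu> xt g' = y) \<longrightarrow>
          feasible_from A B X U \<mu> xt g \<and> predicted A B \<mu> xt g = y) \<and>
        (\<forall>i\<in>{1..\<mu>}. ut i = (1 - a) *\<^sub>R vh i + a *\<^sub>R g i)"
      using step False
      unfolding algorithm_step_def Let_def vh_def[symmetric] xh_def[symmetric] xq_def[symmetric]
        e_def[symmetric] db_def[symmetric] a_def[symmetric] y_def[symmetric]
      by auto
    with g' obtain g where g: "feasible_from A B X U \<mu> xt g" "predicted A B \<mu> xt g = y"
      "\<forall>i\<in>{1..\<mu>}. ut i = (1 - a) *\<^sub>R vh i + a *\<^sub>R g i"
      by blast
    have a: "a * (1 + db) = 1" using db by (simp add: a_def)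
    \<comment> \<open>The weight \<open>a\<close> is the one for which \<open>xq\<close> divides the
      segment from \<open>xh\<close> to \<open>y\<close>.\<close>
    have "(1 - a) *\<^sub>R xh + a *\<^sub>R y = (a * (1 + db)) *\<^sub>R xq + (1 - a * (1 + db)) *\<^sub>R xh"
      by (simp add: y_def algebra_simps)
    also have "\<dots> = xq" by (simp add: a)
    finally have "(1 - a) *\<^sub>R xh + a *\<^sub>R y = xq" .
    moreover have "0 \<le> a" "a \<le> 1" using db by (auto simp: a_def)
    moreover have "a \<le> 1 / db" using db by (auto simp: a_def field_simps)
    then have "a \<le> e / \<delta>" by (simp add: db_def)
    ultimately show ?thesis using g by blast
  qed
  then obtain a g where g: "feasible_from A B X U \<mu> xt g" and a: "0 \<le> a" "a \<le> 1" "a \<le> e / \<delta>"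
    and ut: "\<And>i. i \<in> {1..\<mu>} \<Longrightarrow> ut i = (1 - a) *\<^sub>R vh i + a *\<^sub>R g i"
    and xq_eq: "(1 - a) *\<^sub>R xh + a *\<^sub>R predicted A B \<mu> xt g = xq"
    by blast
  have "state A B xt ut \<mu> = (1 - a) *\<^sub>R state A B xt vh \<mu> + a *\<^sub>R state A B xt g \<mu>"
    unfolding state_convex_combination[symmetric] using ut by (intro state_cong) auto
  then have final: "predicted A B \<mu> xt ut = xq"
    using xq_eq by (simp add: predicted_eq_state xh_def)
  have vhU: "vh i \<in> U" if "i \<in> {1..\<mu>}" for i
    using that xp(2) \<open>vt \<in> U\<close> by (auto simp: vh_def feasible_from_def)
  have vhX: "state A B xt vh k \<in> X" if "k < \<mu>" for k
    using shift[OF that] that state_feasible_in_X[OF xp, of "Suc k"] by simp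
  have finalX: "state A B xt ut \<mu> \<in> X"
    using final xq Xbar_subset by (auto simp: predicted_eq_state)
  note comb = feasible_from_convex_combination[OF xt a(1,2) g vhU vhX ut finalX]
  show thesis
  proof (rule that[of xh a])
    show "predicted A B \<mu> xt ut = closest_point Xbar (xh - \<gamma>x *\<^sub>R gradient_within fxp D xh)"
      using final by (simp add: xq_def)
    show "a \<le> norm (xh - predicted A B \<mu> xt ut) / \<delta>"
      using a by (simp add: final e_def)
    show "dist (state A B xt ut k) (state A B xp up (Suc k)) \<le> a * diameter X" if "k < \<mu>" for k
      using comb(2)[OF _ _ _ that] shift[OF that] by simp
    show "dist (ut i) (if i < \<mu> then up (i + 1) else vt) \<le> a * diameter U" if "i \<in> {1..\<mu>}" for i
      using comb(3)[OF _ _ _ that] by (simp add: vh_def)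
  qed (use vt xh \<open>xh \<in> D\<close> a comb(1) in auto)
qed

end

section \<open>Summation over the horizon\<close>

text \<open>The recursion is summed instead of solved: its right side reproduces \<open>r\<close>
  times the whole sum, which is moved to the left.\<close>

lemma sum_le_of_linear_recursion:
  fixes s d :: "nat \<Rightarrow> real"
  assumes "0 \<le> r" "s 0 = 0" "\<And>t. t \<le> T \<Longrightarrow> 0 \<le> s t"
    and rec: "\<And>t. t \<in> {1..T} \<Longrightarrow> s t \<le> r * s (t - 1) + d t"
  shows "(1 - r) * (\<Sum>t=0..T. s t) \<le> (\<Sum>t=1..T. d t)"
proof -
  have "(\<Sum>t=0..T. s t) = (\<Sum>t=1..T. s t)"
    using \<open>s 0 = 0\<close> by (simp add: sum.atLeast_Suc_atMost)
  also have "\<dots> \<le> r * (\<Sum>t=1..T. s (t - 1)) + (\<Sum>t=1..T. d t)"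
    unfolding sum_distrib_left sum.distrib[symmetric] using rec by (rule sum_mono)
  also have "(\<Sum>t=1..T. s (t - 1)) = (\<Sum>t<T. s t)"
    by (rule sum.reindex_bij_witness[of _ Suc "\<lambda>t. t - 1"]) auto
  also have "r * (\<Sum>t<T. s t) \<le> r * (\<Sum>t=0..T. s t)"
    using assms by (intro mult_left_mono sum_mono2) auto
  finally show ?thesis by (simp add: algebra_simps)
qed

lemma sum_pred_le:
  fixes c :: "nat \<Rightarrow> real"
  assumes "\<And>t. 0 \<le> c t"
  shows "(\<Sum>t=1..T. c (t - 1)) \<le> (\<Sum>t=0..T. c t)"
proof -
  have "(\<Sum>t=1..T. c (t - 1)) = (\<Sum>t<T. c t)"
    by (rule sum.reindex_bij_witness[of _ Suc "\<lambda>t. t - 1"]) auto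
  also have "\<dots> \<le> (\<Sum>t=0..T. c t)" using assms by (intro sum_mono2) auto
  finally show ?thesis .
qed

lemma sum_shifted_le:
  fixes c :: "nat \<Rightarrow> real"
  assumes "\<And>t. 0 \<le> c t" "i \<le> k"
  shows "(\<Sum>t=k..T. c (t - i)) \<le> (\<Sum>t=0..T. c t)"
proof -
  \<comment> \<open>Truncated subtraction is injective here because
    \<open>i \<le> k\<close>.\<close>
  have "inj_on (\<lambda>t. t - i) {k..T}" using assms(2) by (auto simp: inj_on_def)
  then have "(\<Sum>t=k..T. c (t - i)) = (\<Sum>t\<in>(\<lambda>t. t - i) ` {k..T}. c t)"
    by (simp add: sum.reindex)
  also have "\<dots> \<le> (\<Sum>t=0..T. c t)" using assms by (intro sum_mono2) auto
  finally show ?thesis .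
qed

text \<open>After swapping the sums, each of the \<open>n\<close> shifts contributes at most the
  full sum; \<open>n \<le> Suc k\<close> rules out truncation of \<open>t - i\<close>.\<close>

lemma sum_windows_le:
  fixes c :: "nat \<Rightarrow> real"
  assumes "\<And>t. 0 \<le> c t" "n \<le> Suc k"
  shows "(\<Sum>t=k..T. \<Sum>i<n. c (t - i)) \<le> real n * (\<Sum>t=0..T. c t)"
proof -
  have "(\<Sum>t=k..T. \<Sum>i<n. c (t - i)) = (\<Sum>i<n. \<Sum>t=k..T. c (t - i))"
    by (rule sum.swap)
  also have "\<dots> \<le> (\<Sum>i<n. \<Sum>t=0..T. c t)"
    using assms by (intro sum_mono sum_shifted_le) auto
  finally show ?thesis by simp
qed

text \<open>For an initial phase of length \<open>k\<close> that has only a uniform bound; horizons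
  shorter than this phase are included.\<close>

lemma sum_le_head_tail:
  fixes h b :: "nat \<Rightarrow> real"
  assumes "0 \<le> M" "\<And>t. t < k \<Longrightarrow> t \<le> T \<Longrightarrow> h t \<le> M" "\<And>t. k \<le> t \<Longrightarrow> t \<le> T \<Longrightarrow> h t \<le> b t"
  shows "(\<Sum>t=0..T. h t) \<le> real k * M + (\<Sum>t=k..T. b t)"
proof -
  have "{0..T} = ({0..T} \<inter> {..<k}) \<union> {k..T}" by auto
  then have "(\<Sum>t=0..T. h t) = (\<Sum>t\<in>{0..T} \<inter> {..<k}. h t) + (\<Sum>t=k..T. h t)"
    by (metis (no_types, lifting) Int_iff atLeastAtMost_iff disjoint_iff finite_Int
        finite_atLeastAtMost lessThan_iff not_less sum.union_disjoint)
  also have "(\<Sum>t\<in>{0..T} \<inter> {..<k}. h t) \<le> real (card ({0..T} \<inter> {..<k})) * M"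
    using assms(2) by (intro sum_bounded_above) auto
  also have "\<dots> \<le> real k * M"
  proof -
    have "card ({0..T} \<inter> {..<k}) \<le> card {..<k}" by (intro card_mono) auto
    then show ?thesis using \<open>0 \<le> M\<close> by (intro mult_right_mono) auto
  qed
  also have "(\<Sum>t=k..T. h t) \<le> (\<Sum>t=k..T. b t)"
    using assms(3) by (intro sum_mono) auto
  finally show ?thesis by simp
qed

lemma dist_Suc_le_sum_steps:
  fixes s :: "nat \<Rightarrow> 'a::metric_space"
  assumes "k \<le> Suc t"
  shows "dist (s (Suc t)) (s (Suc t - k)) \<le> (\<Sum>i<k. dist (s (Suc (t - i))) (s (t - i)))"
  using assms
proof (induction k)
  case (Suc k)
  then have "dist (s (Suc t - k)) (s (Suc t - Suc k)) = dist (s (Suc (t - k))) (s (t - k))"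
    by (simp add: Suc_diff_le)
  then show ?case
    using Suc dist_triangle[of "s (Suc t)" "s (Suc t - Suc k)" "s (Suc t - k)"] by simp
qed simp

lemma norm_matrix_vector_mult_le: "norm (A *v x) \<le> onorm ((*v) A) * norm x"
  for A :: "real^'n^'m"
  by (rule onorm) (rule matrix_vector_mul_bounded_linear)

section \<open>Runs of the algorithm\<close>

text \<open>Fixes one run together with the internal sequences \<open>v\<close> and
  \<open>uh\<close>, which \<open>algorithm_run\<close> hides behind an existential
  quantifier.\<close>

locale online_run = constrained_system A B X Xbar U \<delta> \<mu>
  for A :: "real^'n^'n" and B :: "real^'m^'n"
    and X Xbar :: "(real^'n) set" and U :: "(real^'m) set" and \<delta> :: real and \<mu> :: nat +
  fixes D :: "(real^'n) set" and \<alpha>x lx \<alpha>u lu \<gamma>x \<gamma>u :: real and T :: nat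
    and fx :: "nat \<Rightarrow> real^'n \<Rightarrow> real" and fu :: "nat \<Rightarrow> real^'m \<Rightarrow> real"
    and x :: "nat \<Rightarrow> real^'n" and v :: "nat \<Rightarrow> real^'m" and uh :: "nat \<Rightarrow> nat \<Rightarrow> real^'m"
  assumes D: "convex D" "X \<subseteq> D"
    and alpha_pos: "\<alpha>x > 0" "\<alpha>u > 0"
    and gamma_x: "0 < \<gamma>x" "\<gamma>x * (lx + \<alpha>x) \<le> 2"
    and gamma_u: "0 < \<gamma>u" "\<gamma>u * (lu + \<alpha>u) \<le> 2"
    and regular: "costs_regular D U \<alpha>x lx \<alpha>u lu T fx fu"
    and steady: "minimizers_steady A B X U Xbar T fx fu"
    and x_0: "x 0 \<in> X" and feasible_0: "feasible_from A B X U \<mu> (x 0) (uh 0)" and v_0: "v 0 \<in> U"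
    and step: "\<And>t. t \<in> {1..T} \<Longrightarrow>
      algorithm_step A B X U Xbar D \<delta> \<mu> \<gamma>x \<gamma>u (fx (t - 1)) (fu (t - 1))
        (x t) (v (t - 1)) (uh (t - 1)) (v t) (uh t)"
    and dynamics: "\<And>t. t \<le> T \<Longrightarrow> x (Suc t) = A *v x t + B *v uh t 1"
begin

definition \<theta> :: "nat \<Rightarrow> real^'n" where "\<theta> t = arg_min_on (fx t) X"
definition \<eta> :: "nat \<Rightarrow> real^'m" where "\<eta> t = arg_min_on (fu t) U"
definition p :: "nat \<Rightarrow> real^'n" where "p t = predicted A B \<mu> (x t) (uh t)"

text \<open>The minimizers delayed by one step, with the conventional value of \<open>\<theta>\<^sub>-\<^sub>1\<close>, \<open>\<eta>\<^sub>-\<^sub>1\<close> at \<open>0\<close>.\<close>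

definition \<theta>' :: "nat \<Rightarrow> real^'n" where "\<theta>' t = (case t of 0 \<Rightarrow> p 0 | Suc k \<Rightarrow> \<theta> k)"
definition \<eta>' :: "nat \<Rightarrow> real^'m" where "\<eta>' t = (case t of 0 \<Rightarrow> v 0 | Suc k \<Rightarrow> \<eta> k)"

definition \<kappa>x :: real where "\<kappa>x = 1 - \<gamma>x * \<alpha>x"
definition \<kappa>u :: real where "\<kappa>u = 1 - \<gamma>u * \<alpha>u"

text \<open>\<open>v t\<close> and \<open>p t\<close> are computed from the costs of time
  \<open>t - 1\<close>, so the errors refer to the delayed minimizers. Both errors vanish at
  \<open>0\<close> by the convention there.\<close>

definition V :: "nat \<Rightarrow> real" where "V t = dist (v t) (\<eta>' t)"
definition P :: "nat \<Rightarrow> real" where "P t = dist (p t) (\<theta>' t)"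
text \<open>For \<open>t \<ge> 1\<close>, the argument of \<open>dist\<close> in \<open>H t\<close> is the predicted state \<open>\<hat>x\<^sub>t\<^sub>+\<^sub>\<mu>\<close>, and
  \<open>p t\<close> is \<open>x\<^sup>\<pi>\<^sub>t\<^sub>+\<^sub>\<mu>\<close>.\<close>

definition H :: "nat \<Rightarrow> real" where
  "H t = (if t = 0 then 0 else dist (A *v p (t - 1) + B *v v t) (\<theta>' t))"

lemma shift_simps [simp]: "\<theta>' (Suc t) = \<theta> t" "\<eta>' (Suc t) = \<eta> t" "\<theta>' 0 = p 0" "\<eta>' 0 = v 0"
  by (simp_all add: \<theta>'_def \<eta>'_def)

lemma path_variation_theta: "path_variation T (p 0) \<theta> = (\<Sum>t=0..T. dist (\<theta>' (Suc t)) (\<theta>' t))"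
  by (simp add: path_variation_def dist_norm \<theta>'_def)

lemma path_variation_eta: "path_variation T (v 0) \<eta> = (\<Sum>t=0..T. dist (\<eta>' (Suc t)) (\<eta>' t))"
  by (simp add: path_variation_def dist_norm \<eta>'_def)

lemma interior_D: "interior D \<noteq> {}"
  using X(3) D(2) interior_mono by blast

lemma costs:
  assumes "t \<le> T"
  shows "strongly_convex_on \<alpha>x D (fx t)" "smooth_fun_on lx D (fx t)"
    "strongly_convex_on \<alpha>u U (fu t)" "smooth_fun_on lu U (fu t)"
  using regular assms by (auto simp: costs_regular_def)

lemma kappa: "0 \<le> \<kappa>x" "\<kappa>x < 1" "0 \<le> \<kappa>u" "\<kappa>u < 1"
  using contraction_factor_nonneg[OF D(1) interior_D costs(1,2)[of 0]]
    contraction_factor_nonneg[OF U(1,3) costs(3,4)[of 0]] gamma_x gamma_u alpha_pos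
  by (auto simp: \<kappa>x_def \<kappa>u_def)

lemma has_derivative_costs:
  assumes "t \<le> T"
  shows "y \<in> D \<Longrightarrow> (fx t has_derivative (\<lambda>h. gradient_within (fx t) D y \<bullet> h)) (at y within D)"
    and "w \<in> U \<Longrightarrow> (fu t has_derivative (\<lambda>h. gradient_within (fu t) U w \<bullet> h)) (at w within U)"
  using costs[OF assms] D U interior_D
  by (auto simp: smooth_fun_on_def intro!: has_derivative_gradient_within)

lemma minimizers:
  assumes "t \<le> T"
  shows "\<theta> t \<in> Xbar" "\<eta> t \<in> U" "A *v \<theta> t + B *v \<eta> t = \<theta> t"
    and "\<And>y. y \<in> X \<Longrightarrow> fx t (\<theta> t) \<le> fx t y" and "\<And>w. w \<in> U \<Longrightarrow> fu t (\<eta> t) \<le> fu t w"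
proof -
  show "\<theta> t \<in> Xbar" "\<eta> t \<in> U" "A *v \<theta> t + B *v \<eta> t = \<theta> t"
    using steady assms by (auto simp: minimizers_steady_def Let_def \<theta>_def \<eta>_def)
  have "continuous_on D (fx t)" "continuous_on U (fu t)"
    using has_derivative_costs[OF assms] by (auto intro!: has_derivative_continuous_on)
  then have "continuous_on X (fx t)" "continuous_on U (fu t)" 
    using D(2) continuous_on_subset by blast+
  moreover have "X \<noteq> {}" "U \<noteq> {}" using X(3) U(3) by auto
  ultimately show "\<And>y. y \<in> X \<Longrightarrow> fx t (\<theta> t) \<le> fx t y" "\<And>w. w \<in> U \<Longrightarrow> fu t (\<eta> t) \<le> fu t w"
    unfolding \<theta>_def \<eta>_def using X(2) U(2) by (auto intro: arg_min_on_attained)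
qed

text \<open>A \<delta>-ball around the minimizer lies in \<open>X\<close>, so the first-order
  condition may be tested in the direction opposite to the gradient.\<close>

lemma gradient_at_theta:
  assumes "t \<le> T"
  shows "gradient_within (fx t) D (\<theta> t) = 0"
proof (rule ccontr)
  let ?g = "gradient_within (fx t) D (\<theta> t)"
  assume g: "?g \<noteq> 0"
  have "\<theta> t \<in> X" using minimizers(1)[OF assms] Xbar_subset by blast
  have "norm ((- 1 / norm ?g) *\<^sub>R ?g) \<le> 1" by simp
  then have "\<theta> t + \<delta> *\<^sub>R ((- 1 / norm ?g) *\<^sub>R ?g) \<in> X"
    using minimizers(1)[OF assms] unfolding Xbar_eq by blast
  moreover have "(fx t has_derivative (\<lambda>h. ?g \<bullet> h)) (at (\<theta> t) within X)"
    using has_derivative_costs(1)[OF assms] \<open>\<theta> t \<in> X\<close> D(2) has_derivative_subset by blast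
  ultimately have "0 \<le> ?g \<bullet> (\<theta> t + \<delta> *\<^sub>R ((- 1 / norm ?g) *\<^sub>R ?g) - \<theta> t)"
    using X(1) \<open>\<theta> t \<in> X\<close> minimizers(4)[OF assms] by (intro first_order_minimizer)
  moreover have "?g \<bullet> (\<theta> t + \<delta> *\<^sub>R ((- 1 / norm ?g) *\<^sub>R ?g) - \<theta> t) = - \<delta> * norm ?g"
    using g by (simp add: dot_square_norm power2_eq_square)
  ultimately show False using g delta_pos by (simp add: mult_le_0_iff)
qed

text \<open>The gradient step fixes \<open>\<theta> t\<close>, where the gradient vanishes, and so
  does the nonexpansive projection onto \<open>Xbar\<close>. The point \<open>y\<close> ranges over
  \<open>D\<close> because predicted states may leave \<open>X\<close>.\<close>

lemma projected_state_step:
  assumes "t \<le> T" "y \<in> D"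
  shows "dist (closest_point Xbar (y - \<gamma>x *\<^sub>R gradient_within (fx t) D y)) (\<theta> t) \<le> \<kappa>x * dist y (\<theta> t)"
proof -
  have th: "\<theta> t \<in> Xbar" "\<theta> t \<in> D" using minimizers(1)[OF assms(1)] Xbar_subset D(2) by auto
  have "dist (closest_point Xbar (y - \<gamma>x *\<^sub>R gradient_within (fx t) D y)) (closest_point Xbar (\<theta> t))
      \<le> dist (y - \<gamma>x *\<^sub>R gradient_within (fx t) D y) (\<theta> t)"
    using th by (intro closest_point_lipschitz convex_Xbar closed_Xbar) auto
  also have "\<dots> \<le> \<kappa>x * dist y (\<theta> t)"
    using gradient_step_contraction[OF D(1) interior_D costs(1,2)[OF assms(1)] _ gamma_x(2) assms(2) th(2)]
      gamma_x(1)
    by (simp add: gradient_at_theta[OF assms(1)] \<kappa>x_def dist_norm)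
  finally show ?thesis using th by (simp add: closest_point_self)
qed

text \<open>The gradient at \<open>\<eta> t\<close> may be nonzero, so the projected step is
  compared with the projected step from \<open>\<eta> t\<close>, which returns to
  \<open>\<eta> t\<close>.\<close>

lemma projected_input_step:
  assumes "t \<le> T" "w \<in> U"
  shows "dist (closest_point U (w - \<gamma>u *\<^sub>R gradient_within (fu t) U w)) (\<eta> t) \<le> \<kappa>u * dist w (\<eta> t)"
proof -
  have et: "\<eta> t \<in> U" using minimizers[OF assms(1)] by auto
  have closed: "closed U" using U(2) by (rule compact_imp_closed)
  have "dist (closest_point U (w - \<gamma>u *\<^sub>R gradient_within (fu t) U w))
        (closest_point U (\<eta> t - \<gamma>u *\<^sub>R gradient_within (fu t) U (\<eta> t)))
      \<le> dist (w - \<gamma>u *\<^sub>R gradient_within (fu t) U w) (\<eta> t - \<gamma>u *\<^sub>R gradient_within (fu t) U (\<eta> t))"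
    using et U(1) closed by (intro closest_point_lipschitz) auto
  also have "\<dots> \<le> \<kappa>u * dist w (\<eta> t)"
    using gradient_step_contraction[OF U(1,3) costs(3,4)[OF assms(1)] _ gamma_u(2) assms(2) et] gamma_u(1)
    by (simp add: \<kappa>u_def dist_norm)
  also have "closest_point U (\<eta> t - \<gamma>u *\<^sub>R gradient_within (fu t) U (\<eta> t)) = \<eta> t"
    using U(1) closed et has_derivative_costs(2)[OF assms(1) et] minimizers(5)[OF assms(1)] gamma_u(1)
    by (intro closest_point_gradient_step_minimizer) auto
  finally show ?thesis .
qed

text \<open>The gradient vanishes at the minimizer, so smoothness gives a quadratic gap; one of its
  factors is bounded by the diameter.\<close>

lemma state_cost_gap:
  assumes "t \<le> T" "y \<in> X"
  shows "fx t y - fx t (\<theta> t) \<le> lx * diameter X * dist y (\<theta> t)"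
proof -
  have th: "\<theta> t \<in> X" using minimizers(1)[OF assms(1)] Xbar_subset by auto
  have "0 \<le> lx" using costs(2)[OF assms(1)] lipschitz_on_nonneg by (auto simp: smooth_fun_on_def)
  have "fx t y - fx t (\<theta> t) \<le> lx / 2 * (norm (y - \<theta> t))\<^sup>2"
    using smooth_fun_on_upper_bound[OF D(1) interior_D costs(2)[OF assms(1)], of "\<theta> t" y] th assms D(2)
    by (auto simp: gradient_at_theta subset_iff)
  also have "\<dots> = lx / 2 * dist y (\<theta> t) * dist y (\<theta> t)" by (simp add: dist_norm power2_eq_square)
  also have "\<dots> \<le> lx * diameter X * dist y (\<theta> t)"
    using \<open>0 \<le> lx\<close> dist_X_le[OF assms(2) th] by (intro mult_right_mono mult_mono) auto
  finally show ?thesis .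
qed

text \<open>The next state is the first state of the current feasible plan, and an iteration turns a
  feasible plan into a feasible plan.\<close>

lemma run_feasible:
  assumes "t \<le> T"
  shows "x t \<in> X \<and> feasible_from A B X U \<mu> (x t) (uh t) \<and> v t \<in> U"
  using assms
proof (induction t)
  case (Suc t)
  then have IH: "x t \<in> X" "feasible_from A B X U \<mu> (x t) (uh t)" by auto
  have "Xbar \<noteq> {}" using minimizers(1)[of 0] by auto
  have st: "algorithm_step A B X U Xbar D \<delta> \<mu> \<gamma>x \<gamma>u (fx t) (fu t)
      (A *v x t + B *v uh t 1) (v t) (uh t) (v (Suc t)) (uh (Suc t))"
    using step[of "Suc t"] dynamics[of t] Suc.prems by simp
  have "x (Suc t) \<in> X"
    using state_feasible_in_X[OF IH, of 1] mu_pos dynamics[of t] Suc.prems by simp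
  moreover have "feasible_from A B X U \<mu> (x (Suc t)) (uh (Suc t))"
    using dynamics[of t] Suc.prems
    by (auto intro: algorithm_step_properties[OF IH \<open>Xbar \<noteq> {}\<close> st])
  moreover have "v (Suc t) \<in> U"
  proof -
    have "closed U" "U \<noteq> {}" using U(2,3) by (auto intro: compact_imp_closed)
    then have "closest_point U w \<in> U" for w by (rule closest_point_in_set)
    then show ?thesis by (metis algorithm_step_properties[OF IH \<open>Xbar \<noteq> {}\<close> st])
  qed
  ultimately show ?case by blast
qed (use x_0 feasible_0 v_0 in auto)

lemma run_step:
  assumes t: "t \<in> {1..T}"
  shows "V t \<le> \<kappa>u * (V (t - 1) + dist (\<eta>' t) (\<eta>' (t - 1)))"
    and "H t \<le> onorm ((*v) A) * (P (t - 1) + dist (\<theta>' t) (\<theta>' (t - 1))) + onorm ((*v) B) * V t"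
    and "P t \<le> \<kappa>x * H t"
    and "\<And>k. k < \<mu> \<Longrightarrow>
      dist (state A B (x t) (uh t) k) (state A B (x (t - 1)) (uh (t - 1)) (Suc k)) \<le> 2 / \<delta> * diameter X * H t"
    and "\<And>i. i \<in> {1..\<mu>} \<Longrightarrow>
      dist (uh t i) (if i < \<mu> then uh (t - 1) (i + 1) else v t) \<le> 2 / \<delta> * diameter U * H t"
proof -
  obtain s where s: "t = Suc s" "s \<le> T" using t by (cases t) auto
  have feas: "x s \<in> X" "feasible_from A B X U \<mu> (x s) (uh s)" "v s \<in> U"
    using run_feasible s by auto
  have "Xbar \<noteq> {}" using minimizers(1)[of 0] by auto
  have st: "algorithm_step A B X U Xbar D \<delta> \<mu> \<gamma>x \<gamma>u (fx s) (fu s)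
      (A *v x s + B *v uh s 1) (v s) (uh s) (v t) (uh t)"
    using step[OF t] dynamics[OF s(2)] s by simp
  obtain a xh where
    vt: "v t = closest_point U (v s - \<gamma>u *\<^sub>R gradient_within (fu s) U (v s))" and
    xh: "xh = A *v p s + B *v v t" "xh \<in> D" and
    p: "p t = closest_point Xbar (xh - \<gamma>x *\<^sub>R gradient_within (fx s) D xh)" and
    a: "0 \<le> a" "a \<le> norm (xh - p t) / \<delta>" and
    st_diff: "\<And>k. k < \<mu> \<Longrightarrow> dist (state A B (x t) (uh t) k) (state A B (x s) (uh s) (Suc k)) \<le> a * diameter X" and
    uh_diff: "\<And>i. i \<in> {1..\<mu>} \<Longrightarrow> dist (uh t i) (if i < \<mu> then uh s (i + 1) else v t) \<le> a * diameter U"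
    using algorithm_step_properties[OF feas(1,2) \<open>Xbar \<noteq> {}\<close> st] dynamics[OF s(2)]
    unfolding p_def s(1) by metis
  have H: "H t = dist xh (\<theta> s)" by (simp add: H_def s xh)
  have "0 \<le> H t" by (simp add: H)
  have "V t \<le> \<kappa>u * dist (v s) (\<eta> s)"
    using projected_input_step[OF s(2) feas(3)] by (simp add: V_def s vt[unfolded s])
  also have "\<dots> \<le> \<kappa>u * (V s + dist (\<eta>' t) (\<eta>' s))"
    using kappa(3) dist_triangle2[of "v s" "\<eta> s" "\<eta>' s"]
    by (intro mult_left_mono) (auto simp: V_def s)
  finally show "V t \<le> \<kappa>u * (V (t - 1) + dist (\<eta>' t) (\<eta>' (t - 1)))" by (simp add: s)
  have "xh - \<theta> s = xh - (A *v \<theta> s + B *v \<eta> s)" using minimizers(3)[OF s(2)] by simp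
  also have "\<dots> = A *v (p s - \<theta> s) + B *v (v t - \<eta> s)"
    by (simp add: xh matrix_vector_mult_diff_distrib)
  finally have "H t \<le> norm (A *v (p s - \<theta> s)) + norm (B *v (v t - \<eta> s))"
    by (simp add: H dist_norm norm_triangle_ineq)
  also have "\<dots> \<le> onorm ((*v) A) * dist (p s) (\<theta> s) + onorm ((*v) B) * V t"
    by (intro add_mono) (simp_all add: norm_matrix_vector_mult_le V_def s dist_norm)
  \<comment> \<open>Changing the reference point from \<open>\<theta> s = \<theta>' t\<close> to
    \<open>\<theta>' s\<close> costs one term of the path variation.\<close>
  also have "\<dots> \<le> onorm ((*v) A) * (P s + dist (\<theta>' t) (\<theta>' s)) + onorm ((*v) B) * V t"
    using dist_triangle2[of "p s" "\<theta> s" "\<theta>' s"]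
    by (intro add_right_mono mult_left_mono)
      (auto simp: P_def s onorm_pos_le matrix_vector_mul_bounded_linear)
  finally show "H t \<le> onorm ((*v) A) * (P (t - 1) + dist (\<theta>' t) (\<theta>' (t - 1))) + onorm ((*v) B) * V t"
    by (simp add: s)
  show P: "P t \<le> \<kappa>x * H t"
    using projected_state_step[OF s(2) xh(2)] by (simp add: P_def s H[unfolded s] p[unfolded s])
  \<comment> \<open>The correction length is measured through \<open>\<theta> s\<close>;
    \<open>P t \<le> H t\<close> gives the factor \<open>2\<close> in the deviation bounds.\<close>
  have "norm (xh - p t) \<le> H t + P t"
    using dist_triangle2[of xh "p t" "\<theta> s"] unfolding H P_def by (simp add: s dist_norm)
  also have "\<dots> \<le> 2 * H t"
    using P mult_right_mono[of \<kappa>x 1, OF _ \<open>0 \<le> H t\<close>] kappa by simp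
  finally have "norm (xh - p t) / \<delta> \<le> 2 * H t / \<delta>"
    using delta_pos by (intro divide_right_mono) auto
  then have a': "a \<le> 2 / \<delta> * H t" using a by simp
  have aX: "a * diameter X \<le> 2 / \<delta> * diameter X * H t"
    using mult_right_mono[OF a' diameters_nonneg(1)] by (simp only: ac_simps)
  have aU: "a * diameter U \<le> 2 / \<delta> * diameter U * H t"
    using mult_right_mono[OF a' diameters_nonneg(2)] by (simp only: ac_simps)
  show "dist (state A B (x t) (uh t) k) (state A B (x (t - 1)) (uh (t - 1)) (Suc k)) \<le> 2 / \<delta> * diameter X * H t"
    if "k < \<mu>" for k
    using order_trans[OF st_diff[OF that] aX] by (simp only: s(1) diff_Suc_1)
  show "dist (uh t i) (if i < \<mu> then uh (t - 1) (i + 1) else v t) \<le> 2 / \<delta> * diameter U * H t"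
    if "i \<in> {1..\<mu>}" for i
    using order_trans[OF uh_diff[OF that] aU] by (simp only: s(1) diff_Suc_1)
qed

section \<open>Tracking errors of the applied states and inputs\<close>

lemma nonneg: "0 \<le> V t" "0 \<le> P t" "0 \<le> H t"
  by (simp_all add: V_def P_def H_def)

text \<open>State \<open>k\<close> of the plan made at time \<open>t - k\<close> always predicts
  time \<open>t\<close>. Going back from \<open>k = 0\<close> to \<open>k = \<mu>\<close> leads from
  \<open>x t\<close> to \<open>p (t - \<mu>)\<close>, one correction at a time.\<close>

lemma state_tracking:
  assumes t: "\<mu> \<le> t" "t \<le> T"
  shows "dist (x t) (\<theta> t) \<le> (\<Sum>i<\<mu>. 2 / \<delta> * diameter X * H (t - i)) + P (t - \<mu>)
      + (\<Sum>i<Suc \<mu>. dist (\<theta>' (Suc (t - i))) (\<theta>' (t - i)))"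
proof -
  have "dist (x t) (state A B (x (t - k)) (uh (t - k)) k) \<le> (\<Sum>i<k. 2 / \<delta> * diameter X * H (t - i))"
    if "k \<le> \<mu>" for k
    using that
  proof (induction k)
    case (Suc k)
    have "t - k \<in> {1..T}" using Suc.prems t by auto
    then have "dist (state A B (x (t - k)) (uh (t - k)) k) (state A B (x (t - Suc k)) (uh (t - Suc k)) (Suc k))
        \<le> 2 / \<delta> * diameter X * H (t - k)"
      using run_step(4)[of "t - k" k] Suc.prems t by simp
    moreover have "dist (x t) (state A B (x (t - k)) (uh (t - k)) k) \<le> (\<Sum>i<k. 2 / \<delta> * diameter X * H (t - i))"
      using Suc by simp
    ultimately show ?case unfolding sum.lessThan_Suc
      by (intro order_trans[OF dist_triangle add_mono])
  qed simp
  from this[of \<mu>] have "dist (x t) (p (t - \<mu>)) \<le> (\<Sum>i<\<mu>. 2 / \<delta> * diameter X * H (t - i))"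
    by (simp add: p_def predicted_eq_state)
  \<comment> \<open>The window has \<open>Suc \<mu>\<close> terms because \<open>\<theta> t\<close>
    is \<open>\<theta>' (Suc t)\<close>.\<close>
  moreover have "dist (\<theta> t) (\<theta>' (t - \<mu>)) \<le> (\<Sum>i<Suc \<mu>. dist (\<theta>' (Suc (t - i))) (\<theta>' (t - i)))"
    using dist_Suc_le_sum_steps[of "Suc \<mu>" t \<theta>'] t by simp
  moreover have "dist (x t) (\<theta> t) \<le> dist (x t) (p (t - \<mu>)) + P (t - \<mu>) + dist (\<theta> t) (\<theta>' (t - \<mu>))"
    unfolding P_def
    using dist_triangle[of "x t" "\<theta> t" "p (t - \<mu>)"] dist_triangle2[of "p (t - \<mu>)" "\<theta> t" "\<theta>' (t - \<mu>)"]
    by linarith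
  ultimately show ?thesis by linarith
qed

text \<open>The input applied at time \<open>t\<close> entered the plan as its last entry at time
  \<open>t - (\<mu> - 1)\<close>, where it was \<open>v\<close> before the correction of that time.
  Hence the lag is one less than for the states.\<close>

lemma input_tracking:
  assumes t: "\<mu> \<le> t" "t \<le> T"
  shows "dist (uh t 1) (\<eta> t) \<le> (\<Sum>i<\<mu>. 2 / \<delta> * diameter U * H (t - i)) + V (t - (\<mu> - 1))
      + (\<Sum>i<\<mu>. dist (\<eta>' (Suc (t - i))) (\<eta>' (t - i)))"
proof -
  define s where "s = t - (\<mu> - 1)"
  have s: "s \<in> {1..T}" "s = Suc t - \<mu>" using t mu_pos by (auto simp: s_def)
  have "dist (uh t 1) (uh (t - k) (Suc k)) \<le> (\<Sum>i<k. 2 / \<delta> * diameter U * H (t - i))"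
    if "k < \<mu>" for k
    using that
  proof (induction k)
    case (Suc k)
    have "t - k \<in> {1..T}" using Suc.prems t by auto
    then have "dist (uh (t - k) (Suc k)) (uh (t - Suc k) (Suc (Suc k))) \<le> 2 / \<delta> * diameter U * H (t - k)"
      using run_step(5)[of "t - k" "Suc k"] Suc.prems t by simp
    moreover have "dist (uh t 1) (uh (t - k) (Suc k)) \<le> (\<Sum>i<k. 2 / \<delta> * diameter U * H (t - i))"
      using Suc by simp
    ultimately show ?case unfolding sum.lessThan_Suc
      by (intro order_trans[OF dist_triangle add_mono])
  qed simp
  from this[of "\<mu> - 1"] have "dist (uh t 1) (uh s \<mu>) \<le> (\<Sum>i<\<mu> - 1. 2 / \<delta> * diameter U * H (t - i))"
    using mu_pos by (simp add: s_def)
  \<comment> \<open>The last of the \<mu> corrections takes place at time \<open>s\<close> itself,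
    when \<open>v s\<close> enters the plan.\<close>
  moreover have "dist (uh s \<mu>) (v s) \<le> 2 / \<delta> * diameter U * H (t - (\<mu> - 1))"
    using run_step(5)[OF s(1), of \<mu>] mu_pos by (simp add: s_def)
  moreover have "(\<Sum>i<\<mu>. 2 / \<delta> * diameter U * H (t - i))
      = (\<Sum>i<\<mu> - 1. 2 / \<delta> * diameter U * H (t - i)) + 2 / \<delta> * diameter U * H (t - (\<mu> - 1))"
    using mu_pos by (cases \<mu>) auto
  moreover have "dist (\<eta> t) (\<eta>' s) \<le> (\<Sum>i<\<mu>. dist (\<eta>' (Suc (t - i))) (\<eta>' (t - i)))"
    using dist_Suc_le_sum_steps[of \<mu> t \<eta>'] t by (simp add: s(2))
  moreover have "dist (uh t 1) (\<eta> t) \<le> dist (uh t 1) (uh s \<mu>) + dist (uh s \<mu>) (v s) + V s + dist (\<eta> t) (\<eta>' s)"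
    unfolding V_def
    using dist_triangle[of "uh t 1" "\<eta> t" "uh s \<mu>"] dist_triangle[of "uh s \<mu>" "\<eta> t" "v s"]
      dist_triangle2[of "v s" "\<eta> t" "\<eta>' s"]
    by linarith
  ultimately show ?thesis unfolding s_def by linarith
qed

section \<open>Error sums in terms of the path variations\<close>

abbreviation "P\<theta> \<equiv> path_variation T (p 0) \<theta>"
abbreviation "P\<eta> \<equiv> path_variation T (v 0) \<eta>"

text \<open>At the first \<mu> times the error is only bounded by the diameter; these times yield
  the constant term.\<close>

lemma sum_state_tracking:
  "(\<Sum>t=0..T. dist (x t) (\<theta> t)) \<le> real \<mu> * diameter X
    + real \<mu> * (2 / \<delta> * diameter X) * (\<Sum>t=0..T. H t) + (\<Sum>t=0..T. P t) + (real \<mu> + 1) * P\<theta>"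
proof -
  have "(\<Sum>t=0..T. dist (x t) (\<theta> t)) \<le> real \<mu> * diameter X
      + (\<Sum>t=\<mu>..T. (\<Sum>i<\<mu>. 2 / \<delta> * diameter X * H (t - i)) + P (t - \<mu>)
          + (\<Sum>i<Suc \<mu>. dist (\<theta>' (Suc (t - i))) (\<theta>' (t - i))))"
    using run_feasible minimizers(1) Xbar_subset diameters_nonneg
    by (intro sum_le_head_tail dist_X_le state_tracking) auto
  moreover have "(\<Sum>t=\<mu>..T. \<Sum>i<\<mu>. 2 / \<delta> * diameter X * H (t - i))
      \<le> real \<mu> * (\<Sum>t=0..T. 2 / \<delta> * diameter X * H t)"
    using delta_pos diameters_nonneg nonneg by (intro sum_windows_le) auto
  moreover have "(\<Sum>t=\<mu>..T. P (t - \<mu>)) \<le> (\<Sum>t=0..T. P t)"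
    using nonneg by (intro sum_shifted_le) auto
  moreover have "(\<Sum>t=\<mu>..T. \<Sum>i<Suc \<mu>. dist (\<theta>' (Suc (t - i))) (\<theta>' (t - i)))
      \<le> real (Suc \<mu>) * (\<Sum>t=0..T. dist (\<theta>' (Suc t)) (\<theta>' t))"
    by (rule sum_windows_le) auto
  ultimately show ?thesis
    unfolding path_variation_theta sum.distrib sum_distrib_left[symmetric] of_nat_Suc mult.assoc
    by (simp add: add.commute)
qed

lemma sum_input_tracking:
  "(\<Sum>t=0..T. dist (uh t 1) (\<eta> t)) \<le> real \<mu> * diameter U
    + real \<mu> * (2 / \<delta> * diameter U) * (\<Sum>t=0..T. H t) + (\<Sum>t=0..T. V t) + real \<mu> * P\<eta>"
proof -
  have "uh t 1 \<in> U" if "t \<le> T" for t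
    using run_feasible[OF that] mu_pos by (auto simp: feasible_from_def)
  then have "(\<Sum>t=0..T. dist (uh t 1) (\<eta> t)) \<le> real \<mu> * diameter U
      + (\<Sum>t=\<mu>..T. (\<Sum>i<\<mu>. 2 / \<delta> * diameter U * H (t - i)) + V (t - (\<mu> - 1))
          + (\<Sum>i<\<mu>. dist (\<eta>' (Suc (t - i))) (\<eta>' (t - i))))"
    using minimizers(2) diameters_nonneg
    by (intro sum_le_head_tail dist_U_le input_tracking) auto
  moreover have "(\<Sum>t=\<mu>..T. \<Sum>i<\<mu>. 2 / \<delta> * diameter U * H (t - i))
      \<le> real \<mu> * (\<Sum>t=0..T. 2 / \<delta> * diameter U * H t)"
    using delta_pos diameters_nonneg nonneg by (intro sum_windows_le) auto
  moreover have "(\<Sum>t=\<mu>..T. V (t - (\<mu> - 1))) \<le> (\<Sum>t=0..T. V t)"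
    using nonneg by (intro sum_shifted_le) auto
  moreover have "(\<Sum>t=\<mu>..T. \<Sum>i<\<mu>. dist (\<eta>' (Suc (t - i))) (\<eta>' (t - i)))
      \<le> real \<mu> * (\<Sum>t=0..T. dist (\<eta>' (Suc t)) (\<eta>' t))"
    by (rule sum_windows_le) auto
  ultimately show ?thesis
    unfolding path_variation_eta sum.distrib sum_distrib_left[symmetric] mult.assoc
    by simp
qed

lemma sum_V_le: "(\<Sum>t=0..T. V t) \<le> \<kappa>u / (1 - \<kappa>u) * P\<eta>"
proof -
  have "(1 - \<kappa>u) * (\<Sum>t=0..T. V t) \<le> (\<Sum>t=1..T. \<kappa>u * dist (\<eta>' t) (\<eta>' (t - 1)))"
    using kappa nonneg run_step(1) by (intro sum_le_of_linear_recursion) (auto simp: V_def distrib_left)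
  also have "\<dots> = \<kappa>u * (\<Sum>t=1..T. dist (\<eta>' (Suc (t - 1))) (\<eta>' (t - 1)))"
    unfolding sum_distrib_left by (intro sum.cong) auto
  also have "\<dots> \<le> \<kappa>u * P\<eta>"
    unfolding path_variation_eta using kappa by (intro mult_left_mono sum_pred_le[of "\<lambda>t. dist (\<eta>' (Suc t)) (\<eta>' t)"]) auto
  finally show ?thesis using kappa by (simp add: field_simps)
qed

lemma sum_P_le:
  assumes rate: "onorm ((*v) A) * \<kappa>x < 1"
  shows "(\<Sum>t=0..T. P t) \<le> (onorm ((*v) A) * \<kappa>x * P\<theta> + \<kappa>x * onorm ((*v) B) * (\<Sum>t=0..T. V t))
    / (1 - onorm ((*v) A) * \<kappa>x)"
proof -
  let ?a = "onorm ((*v) A)" and ?b = "onorm ((*v) B)"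
  have ab: "0 \<le> ?a" "0 \<le> ?b" by (auto intro!: onorm_pos_le matrix_vector_mul_bounded_linear)
  have rec: "P t \<le> (?a * \<kappa>x) * P (t - 1) + (?a * \<kappa>x * dist (\<theta>' t) (\<theta>' (t - 1)) + \<kappa>x * ?b * V t)"
    if "t \<in> {1..T}" for t
  proof -
    have "P t \<le> \<kappa>x * (?a * (P (t - 1) + dist (\<theta>' t) (\<theta>' (t - 1))) + ?b * V t)"
      using run_step(2,3)[OF that] kappa(1) by (meson mult_left_mono order_trans)
    then show ?thesis by (simp add: algebra_simps)
  qed
  have "(1 - ?a * \<kappa>x) * (\<Sum>t=0..T. P t)
      \<le> (\<Sum>t=1..T. ?a * \<kappa>x * dist (\<theta>' t) (\<theta>' (t - 1)) + \<kappa>x * ?b * V t)"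
    using rec kappa nonneg ab by (intro sum_le_of_linear_recursion) (auto simp: P_def)
  also have "\<dots> = ?a * \<kappa>x * (\<Sum>t=1..T. dist (\<theta>' t) (\<theta>' (t - 1))) + \<kappa>x * ?b * (\<Sum>t=1..T. V t)"
    by (simp add: sum.distrib sum_distrib_left)
  also have "(\<Sum>t=1..T. dist (\<theta>' t) (\<theta>' (t - 1))) = (\<Sum>t=1..T. dist (\<theta>' (Suc (t - 1))) (\<theta>' (t - 1)))"
    by (intro sum.cong) auto
  also have "?a * \<kappa>x * (\<Sum>t=1..T. dist (\<theta>' (Suc (t - 1))) (\<theta>' (t - 1))) + \<kappa>x * ?b * (\<Sum>t=1..T. V t)
      \<le> ?a * \<kappa>x * P\<theta> + \<kappa>x * ?b * (\<Sum>t=0..T. V t)"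
    unfolding path_variation_theta using kappa ab nonneg
    by (intro add_mono mult_left_mono sum_pred_le[of "\<lambda>t. dist (\<theta>' (Suc t)) (\<theta>' t)"] sum_mono2) auto
  finally show ?thesis using rate by (simp add: pos_le_divide_eq mult.commute)
qed

lemma sum_H_le:
  "(\<Sum>t=0..T. H t) \<le> onorm ((*v) A) * ((\<Sum>t=0..T. P t) + P\<theta>) + onorm ((*v) B) * (\<Sum>t=0..T. V t)"
proof -
  let ?a = "onorm ((*v) A)" and ?b = "onorm ((*v) B)"
  have ab: "0 \<le> ?a" "0 \<le> ?b" by (auto intro!: onorm_pos_le matrix_vector_mul_bounded_linear)
  have "(\<Sum>t=0..T. H t) = (\<Sum>t=1..T. H t)" by (simp add: sum.atLeast_Suc_atMost H_def)
  also have "\<dots> \<le> (\<Sum>t=1..T. ?a * (P (t - 1) + dist (\<theta>' (Suc (t - 1))) (\<theta>' (t - 1))) + ?b * V t)"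
    using run_step(2) by (intro sum_mono) auto
  also have "\<dots> = ?a * ((\<Sum>t=1..T. P (t - 1)) + (\<Sum>t=1..T. dist (\<theta>' (Suc (t - 1))) (\<theta>' (t - 1))))
      + ?b * (\<Sum>t=1..T. V t)"
    by (simp only: sum.distrib sum_distrib_left distrib_left)
  also have "\<dots> \<le> ?a * ((\<Sum>t=0..T. P t) + P\<theta>) + ?b * (\<Sum>t=0..T. V t)"
    unfolding path_variation_theta using ab nonneg
    by (intro add_mono mult_left_mono sum_pred_le[of "\<lambda>t. dist (\<theta>' (Suc t)) (\<theta>' t)"] sum_pred_le[of P] sum_mono2) auto
  finally show ?thesis .
qed

text \<open>Costs at the minimizers bound the benchmark costs from below at every time. The state
  gap is estimated by smoothness; the input gap needs the Lipschitz constant \<open>G\<close>, as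
  the gradient at \<open>\<eta> t\<close> may not vanish.\<close>

lemma regret_le_tracking:
  assumes lip: "input_costs_lipschitz G U T fu"
    and bench: "benchmark_solution A B X U x0 T fx fu xs us"
  shows "regret T fx fu x (\<lambda>t. uh t 1) xs us
    \<le> lx * diameter X * (\<Sum>t=0..T. dist (x t) (\<theta> t)) + G * (\<Sum>t=0..T. dist (uh t 1) (\<eta> t))"
proof -
  have opt: "xs t \<in> X" "us t \<in> U" if "t \<le> T" for t
    using bench that by (auto simp: benchmark_solution_def is_arg_min_def)
  have "fx t (x t) + fu t (uh t 1) - (fx t (xs t) + fu t (us t))
      \<le> lx * diameter X * dist (x t) (\<theta> t) + G * dist (uh t 1) (\<eta> t)" if t: "t \<le> T" for t
  proof -
    have "uh t 1 \<in> U" "x t \<in> X" using run_feasible[OF t] mu_pos by (auto simp: feasible_from_def)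
    have "dist (fu t (uh t 1)) (fu t (\<eta> t)) \<le> G * dist (uh t 1) (\<eta> t)"
      using lip t \<open>uh t 1 \<in> U\<close> minimizers(2)[OF t]
      by (intro lipschitz_onD[where X=U]) (auto simp: input_costs_lipschitz_def)
    then have "fu t (uh t 1) - fu t (\<eta> t) \<le> G * dist (uh t 1) (\<eta> t)"
      by (simp add: dist_real_def)
    then show ?thesis
      using state_cost_gap[OF t \<open>x t \<in> X\<close>] minimizers(4)[OF t opt(1)[OF t]] minimizers(5)[OF t opt(2)[OF t]]
      by linarith
  qed
  then show ?thesis
    unfolding regret_def sum_distrib_left sum.distrib[symmetric] by (intro sum_mono) auto
qed


text \<open>The coefficients arise by substitution: \<open>c\<close> bounds the sum of
  \<open>V\<close>, the \<open>q\<close> that of \<open>P\<close>, the \<open>h\<close> that of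
  \<open>H\<close>, and \<open>m\<close> collects the \<mu> corrections. None of them involves
  \<open>T\<close> or the individual costs.\<close>

lemma regret_le_path_variation:
  assumes rate: "onorm ((*v) A) * \<kappa>x < 1"
    and lip: "input_costs_lipschitz G U T fu"
    and bench: "benchmark_solution A B X U x0 T fx fu xs us"
  defines "a \<equiv> onorm ((*v) A)" and "b \<equiv> onorm ((*v) B)" and "c \<equiv> \<kappa>u / (1 - \<kappa>u)" and "m \<equiv> real \<mu> * (2 / \<delta>)"
  defines "q\<theta> \<equiv> a * \<kappa>x / (1 - a * \<kappa>x)" and "q\<eta> \<equiv> \<kappa>x * b * c / (1 - a * \<kappa>x)"
  defines "h\<theta> \<equiv> a * (q\<theta> + 1)" and "h\<eta> \<equiv> a * q\<eta> + b * c"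
  shows "regret T fx fu x (\<lambda>t. uh t 1) xs us
    \<le> (lx * diameter X * (real \<mu> * diameter X) + G * (real \<mu> * diameter U))
      + (lx * diameter X * (m * diameter X * h\<theta> + q\<theta> + real \<mu> + 1) + G * (m * diameter U * h\<theta>)) * P\<theta>
      + (lx * diameter X * (m * diameter X * h\<eta> + q\<eta>) + G * (m * diameter U * h\<eta> + c + real \<mu>)) * P\<eta>"
proof -
  define SV SP SH where "SV = (\<Sum>t=0..T. V t)" and "SP = (\<Sum>t=0..T. P t)" and "SH = (\<Sum>t=0..T. H t)"
  have ab: "0 \<le> a" "0 \<le> b"
    unfolding a_def b_def by (auto intro!: onorm_pos_le matrix_vector_mul_bounded_linear)
  have m: "0 \<le> m" using delta_pos by (simp add: m_def)
  have SV: "SV \<le> c * P\<eta>" using sum_V_le by (simp add: SV_def c_def)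
  have "SP \<le> (a * \<kappa>x * P\<theta> + \<kappa>x * b * SV) / (1 - a * \<kappa>x)"
    using sum_P_le[OF rate] by (simp add: SV_def SP_def a_def b_def)
  also have "\<dots> \<le> (a * \<kappa>x * P\<theta> + \<kappa>x * b * (c * P\<eta>)) / (1 - a * \<kappa>x)"
    using SV ab kappa rate by (intro divide_right_mono add_left_mono mult_left_mono) (auto simp: a_def)
  also have "\<dots> = q\<theta> * P\<theta> + q\<eta> * P\<eta>" by (simp add: q\<theta>_def q\<eta>_def add_divide_distrib)
  finally have SP: "SP \<le> q\<theta> * P\<theta> + q\<eta> * P\<eta>" .
  have "SH \<le> a * (SP + P\<theta>) + b * SV"
    using sum_H_le by (simp add: SV_def SP_def SH_def a_def b_def)
  also have "\<dots> \<le> a * (q\<theta> * P\<theta> + q\<eta> * P\<eta> + P\<theta>) + b * (c * P\<eta>)"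
    using SP SV ab by (intro add_mono mult_left_mono) auto
  finally have SH: "SH \<le> h\<theta> * P\<theta> + h\<eta> * P\<eta>" by (simp add: h\<theta>_def h\<eta>_def algebra_simps)
  have "(\<Sum>t=0..T. dist (x t) (\<theta> t))
      \<le> real \<mu> * diameter X + m * diameter X * SH + SP + (real \<mu> + 1) * P\<theta>"
    using sum_state_tracking by (simp add: SH_def SP_def m_def mult.assoc)
  also have "\<dots> \<le> real \<mu> * diameter X + m * diameter X * (h\<theta> * P\<theta> + h\<eta> * P\<eta>)
      + (q\<theta> * P\<theta> + q\<eta> * P\<eta>) + (real \<mu> + 1) * P\<theta>"
    using SH SP m diameters_nonneg by (intro add_mono mult_left_mono) auto
  finally have Sx: "(\<Sum>t=0..T. dist (x t) (\<theta> t)) \<le> \<dots>" .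
  have "(\<Sum>t=0..T. dist (uh t 1) (\<eta> t))
      \<le> real \<mu> * diameter U + m * diameter U * SH + SV + real \<mu> * P\<eta>"
    using sum_input_tracking by (simp add: SH_def SV_def m_def mult.assoc)
  also have "\<dots> \<le> real \<mu> * diameter U + m * diameter U * (h\<theta> * P\<theta> + h\<eta> * P\<eta>) + c * P\<eta> + real \<mu> * P\<eta>"
    using SH SV m diameters_nonneg by (intro add_mono mult_left_mono) auto
  finally have Su: "(\<Sum>t=0..T. dist (uh t 1) (\<eta> t)) \<le> \<dots>" .
  have "0 \<le> G" using lip lipschitz_on_nonneg by (fastforce simp: input_costs_lipschitz_def)
  have "0 \<le> lx" using costs(2)[of 0] lipschitz_on_nonneg by (auto simp: smooth_fun_on_def)
  note regret_le_tracking[OF lip bench]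
  also have "lx * diameter X * (\<Sum>t=0..T. dist (x t) (\<theta> t)) + G * (\<Sum>t=0..T. dist (uh t 1) (\<eta> t))
      \<le> lx * diameter X * (real \<mu> * diameter X + m * diameter X * (h\<theta> * P\<theta> + h\<eta> * P\<eta>)
          + (q\<theta> * P\<theta> + q\<eta> * P\<eta>) + (real \<mu> + 1) * P\<theta>)
        + G * (real \<mu> * diameter U + m * diameter U * (h\<theta> * P\<theta> + h\<eta> * P\<eta>) + c * P\<eta> + real \<mu> * P\<eta>)"
    using Sx Su \<open>0 \<le> G\<close> \<open>0 \<le> lx\<close> diameters_nonneg by (intro add_mono mult_left_mono) auto
  also have "\<dots> = (lx * diameter X * (real \<mu> * diameter X) + G * (real \<mu> * diameter U))
      + (lx * diameter X * (m * diameter X * h\<theta> + q\<theta> + real \<mu> + 1) + G * (m * diameter U * h\<theta>)) * P\<theta>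
      + (lx * diameter X * (m * diameter X * h\<eta> + q\<eta>) + G * (m * diameter U * h\<eta> + c + real \<mu>)) * P\<eta>"
    by algebra
  finally show ?thesis .
qed

end

text \<open>The initial plan agrees with \<open>uinit\<close> only at the indices \<open>1\<close>
  to \<mu>, so feasibility and the predicted state are transferred through
  \<open>state_cong\<close>.\<close>

lemma (in constrained_system) algorithm_run_is_online_run:
  assumes D: "convex D" "X \<subseteq> D"
    and alpha_pos: "\<alpha>x > 0" "\<alpha>u > 0"
    and gamma_x: "0 < \<gamma>x" "\<gamma>x * (lx + \<alpha>x) \<le> 2"
    and gamma_u: "0 < \<gamma>u" "\<gamma>u * (lu + \<alpha>u) \<le> 2"
    and x0: "x0 \<in> X" and init: "feasible_from A B X U \<mu> x0 uinit" "v0 \<in> U"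
    and regular: "costs_regular D U \<alpha>x lx \<alpha>u lu T fx fu"
    and steady: "minimizers_steady A B X U Xbar T fx fu"
    and run: "algorithm_run A B X U Xbar D \<delta> \<mu> \<gamma>x \<gamma>u x0 uinit v0 T fx fu x u"
  obtains v uh where
    "online_run A B X Xbar U \<delta> \<mu> D \<alpha>x lx \<alpha>u lu \<gamma>x \<gamma>u T fx fu x v uh"
    "\<And>t. t \<le> T \<Longrightarrow> u t = uh t 1" "v 0 = v0"
    "predicted A B \<mu> (x 0) (uh 0) = predicted A B \<mu> x0 uinit"
proof -
  obtain v uh where run: "x 0 = x0" "v 0 = v0" "\<forall>i\<in>{1..\<mu>}. uh 0 i = uinit i"
    "\<forall>t\<in>{1..T}. algorithm_step A B X U Xbar D \<delta> \<mu> \<gamma>x \<gamma>u (fx (t - 1)) (fu (t - 1))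
       (x t) (v (t - 1)) (uh (t - 1)) (v t) (uh t)"
    "\<forall>t\<in>{0..T}. u t = uh t 1 \<and> x (t + 1) = A *v x t + B *v u t"
    using run unfolding algorithm_run_def by blast
  have st: "state A B x0 (uh 0) k = state A B x0 uinit k" if "k \<le> \<mu>" for k
    using run(3) that by (intro state_cong) auto
  show thesis
  proof (rule that)
    show "online_run A B X Xbar U \<delta> \<mu> D \<alpha>x lx \<alpha>u lu \<gamma>x \<gamma>u T fx fu x v uh"
    proof unfold_locales
      show "feasible_from A B X U \<mu> (x 0) (uh 0)"
        using init(1) run(1,3) st by (auto simp: feasible_from_def)
    qed (use assms run in auto)
    show "predicted A B \<mu> (x 0) (uh 0) = predicted A B \<mu> x0 uinit"
      by (simp add: predicted_eq_state run(1) st)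
  qed (use run in auto)
qed

text \<open>The step size forces \<open>s\<close> to be positive: for \<open>s \<le> 0\<close>,
  including division by zero, \<open>2 / s\<close> is not positive.\<close>

lemma step_size_times_le_two:
  fixes \<gamma> s :: real
  assumes "0 < \<gamma>" "\<gamma> \<le> 2 / s"
  shows "\<gamma> * s \<le> 2"
proof -
  have "0 < 2 / s" using assms by linarith
  then have "0 < s" by (simp add: zero_less_divide_iff)
  then show ?thesis using assms by (simp add: pos_le_divide_eq)
qed

theorem theorem7:
  fixes A :: "real^'n^'n" and B :: "real^'m^'n"
    and Cx :: "real^'n^'p" and dx :: "real^'p"
    and Cu :: "real^'m^'q" and du :: "real^'q"
    and X Xbar D :: "(real^'n) set" and U :: "(real^'m) set"
    and \<alpha>x lx \<alpha>u lu \<delta> \<gamma>x \<gamma>u :: real and \<mu> :: nat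
    and x0 :: "real^'n" and uinit :: "nat \<Rightarrow> real^'m" and v0 :: "real^'m"
  assumes X_eq: "X = {x. Cx *v x \<le> dx}" and U_eq: "U = {u. Cu *v u \<le> du}"
    and X_polytope: "polytope X" "0 \<in> interior X"
    and U_polytope: "polytope U" "0 \<in> interior U"
    and Xbar_eq: "Xbar = {x. \<forall>r. norm r \<le> 1 \<longrightarrow> Cx *v (x + \<delta> *\<^sub>R r) \<le> dx}"
    and delta_pos: "\<delta> > 0"
    and D: "convex D" "X \<subseteq> D"
    and alpha_pos: "\<alpha>x > 0" "\<alpha>u > 0"
    and controllable: "controllable A B"
    and norm_A: "lx = \<alpha>x \<or> onorm ((*v) A) < (lx + \<alpha>x) / (lx - \<alpha>x)"
    and steering: "\<forall>x\<in>X. \<forall>y\<in>X. \<exists>us. feasible_from A B X U \<mu> x us \<and> predicted A B \<mu> x us = y"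
    and x0: "x0 \<in> X"
    and init: "feasible_from A B X U \<mu> x0 uinit" "v0 \<in> U"
    and gamma_u: "0 < \<gamma>u" "\<gamma>u \<le> 2 / (lu + \<alpha>u)"
    and gamma_x: "0 < \<gamma>x" "(onorm ((*v) A) - 1) / (onorm ((*v) A) * \<alpha>x) < \<gamma>x"
      "\<gamma>x \<le> 2 / (lx + \<alpha>x)"
  shows
    "(\<forall>G. \<exists>C0>0. \<exists>C\<theta>>0. \<exists>C\<eta>>0. \<forall>T fx fu x u xs us.
        costs_regular D U \<alpha>x lx \<alpha>u lu T fx fu \<and>
        minimizers_steady A B X U Xbar T fx fu \<and>
        input_costs_lipschitz G U T fu \<and>
        algorithm_run A B X U Xbar D \<delta> \<mu> \<gamma>x \<gamma>u x0 uinit v0 T fx fu x u \<and>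
        benchmark_solution A B X U x0 T fx fu xs us
        \<longrightarrow> regret T fx fu x u xs us
              \<le> C0 + C\<theta> * path_variation T (predicted A B \<mu> x0 uinit) (\<lambda>t. arg_min_on (fx t) X)
                   + C\<eta> * path_variation T v0 (\<lambda>t. arg_min_on (fu t) U)) \<and>
     (\<forall>T fx fu x u.
        costs_regular D U \<alpha>x lx \<alpha>u lu T fx fu \<and>
        minimizers_steady A B X U Xbar T fx fu \<and>
        algorithm_run A B X U Xbar D \<delta> \<mu> \<gamma>x \<gamma>u x0 uinit v0 T fx fu x u
        \<longrightarrow> (\<forall>t\<in>{0..T}. x t \<in> X \<and> u t \<in> U))"
proof -
  interpret constrained_system A B X Xbar U \<delta> \<mu>
  proof
    show "convex X" "compact X" "convex U" "compact U"
      using X_polytope(1) U_polytope(1) by (auto simp: polytope_imp_convex polytope_imp_compact)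
    show "Xbar = {x. \<forall>r. norm r \<le> 1 \<longrightarrow> x + \<delta> *\<^sub>R r \<in> X}"
      by (simp add: Xbar_eq X_eq)
    show "\<exists>us. feasible_from A B X U \<mu> x us \<and> predicted A B \<mu> x us = y" if "x \<in> X" "y \<in> X" for x y
      using steering that by blast
  qed (use X_polytope U_polytope delta_pos in auto)
  note gx = gamma_x(1) step_size_times_le_two[OF gamma_x(1,3)]
  note gu = gamma_u(1) step_size_times_le_two[OF gamma_u]
  note online = algorithm_run_is_online_run[OF D alpha_pos gx gu x0 init]
  define a where "a = onorm ((*v) A)"
  define b where "b = onorm ((*v) B)"
  define \<kappa>x where "\<kappa>x = 1 - \<gamma>x * \<alpha>x"
  define \<kappa>u where "\<kappa>u = 1 - \<gamma>u * \<alpha>u"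
  have "0 \<le> a" unfolding a_def by (intro onorm_pos_le matrix_vector_mul_bounded_linear)
  have rate: "a * \<kappa>x < 1"
  \<comment> \<open>For \<open>a = 0\<close> the lower bound on \<open>\<gamma>x\<close> divides by
    zero, but then the rate is \<open>0\<close>.\<close>
  proof (cases "a = 0")
    case False
    then have "0 < a * \<alpha>x" using \<open>0 \<le> a\<close> alpha_pos(1) by simp
    then have "a - 1 < \<gamma>x * (a * \<alpha>x)" using gamma_x(2) by (simp add: pos_divide_less_eq a_def)
    then show ?thesis by (simp add: \<kappa>x_def algebra_simps)
  qed simp
  define c where "c = \<kappa>u / (1 - \<kappa>u)"
  define m where "m = real \<mu> * (2 / \<delta>)"
  define q\<theta> where "q\<theta> = a * \<kappa>x / (1 - a * \<kappa>x)"
  define q\<eta> where "q\<eta> = \<kappa>x * b * c / (1 - a * \<kappa>x)"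
  define h\<theta> where "h\<theta> = a * (q\<theta> + 1)"
  define h\<eta> where "h\<eta> = a * q\<eta> + b * c"
  \<comment> \<open>The constants are fixed before \<open>T\<close>, the costs and the run are
    introduced, and depend only on the system data and \<open>G\<close>.\<close>
  define K0 where "K0 G = lx * diameter X * (real \<mu> * diameter X) + G * (real \<mu> * diameter U)" for G
  define K\<theta> where "K\<theta> G = lx * diameter X * (m * diameter X * h\<theta> + q\<theta> + real \<mu> + 1)
    + G * (m * diameter U * h\<theta>)" for G
  define K\<eta> where "K\<eta> G = lx * diameter X * (m * diameter X * h\<eta> + q\<eta>)
    + G * (m * diameter U * h\<eta> + c + real \<mu>)" for G
  note K = K0_def K\<theta>_def K\<eta>_def h\<theta>_def h\<eta>_def q\<theta>_def q\<eta>_def m_def c_def a_def b_def \<kappa>x_def \<kappa>u_def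
  \<comment> \<open>Absolute values and \<open>+ 1\<close> make the constants positive for every
    real \<open>G\<close>; the path variations are nonnegative, so the bound survives.\<close>
  have bound: "regret T fx fu x u xs us
      \<le> (\<bar>K0 G\<bar> + 1) + (\<bar>K\<theta> G\<bar> + 1) * path_variation T (predicted A B \<mu> x0 uinit) (\<lambda>t. arg_min_on (fx t) X)
        + (\<bar>K\<eta> G\<bar> + 1) * path_variation T v0 (\<lambda>t. arg_min_on (fu t) U)"
    if costs: "costs_regular D U \<alpha>x lx \<alpha>u lu T fx fu" and steady: "minimizers_steady A B X U Xbar T fx fu"
      and lip: "input_costs_lipschitz G U T fu"
      and run: "algorithm_run A B X U Xbar D \<delta> \<mu> \<gamma>x \<gamma>u x0 uinit v0 T fx fu x u"
      and bench: "benchmark_solution A B X U x0 T fx fu xs us"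
    for G T fx fu x u xs us
  proof -
    obtain v uh where online_run: "online_run A B X Xbar U \<delta> \<mu> D \<alpha>x lx \<alpha>u lu \<gamma>x \<gamma>u T fx fu x v uh"
      and eq: "\<And>t. t \<le> T \<Longrightarrow> u t = uh t 1" "v 0 = v0"
        "predicted A B \<mu> (x 0) (uh 0) = predicted A B \<mu> x0 uinit"
      using online[OF costs steady run] by blast
    interpret r: online_run A B X Xbar U \<delta> \<mu> D \<alpha>x lx \<alpha>u lu \<gamma>x \<gamma>u T fx fu x v uh by (rule online_run)
    let ?P = "path_variation T (predicted A B \<mu> x0 uinit) (\<lambda>t. arg_min_on (fx t) X)"
    let ?Q = "path_variation T v0 (\<lambda>t. arg_min_on (fu t) U)"
    have theta: "r.\<theta> = (\<lambda>t. arg_min_on (fx t) X)" "r.\<eta> = (\<lambda>t. arg_min_on (fu t) U)"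
      by (auto simp: r.\<theta>_def r.\<eta>_def)
    have "onorm ((*v) A) * r.\<kappa>x < 1" using rate by (simp add: a_def \<kappa>x_def r.\<kappa>x_def)
    from r.regret_le_path_variation[OF this lip bench]
    have "regret T fx fu x (\<lambda>t. uh t 1) xs us \<le> K0 G + K\<theta> G * ?P + K\<eta> G * ?Q"
      unfolding theta r.p_def eq(2,3) r.\<kappa>x_def r.\<kappa>u_def K .
    moreover have "regret T fx fu x u xs us = regret T fx fu x (\<lambda>t. uh t 1) xs us"
      unfolding regret_def using eq(1) by (intro sum.cong) auto
    moreover have "0 \<le> ?P" "0 \<le> ?Q" by (auto simp: path_variation_def intro!: sum_nonneg)
    then have "K\<theta> G * ?P \<le> (\<bar>K\<theta> G\<bar> + 1) * ?P" "K\<eta> G * ?Q \<le> (\<bar>K\<eta> G\<bar> + 1) * ?Q"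
      by (auto intro!: mult_right_mono)
    ultimately show ?thesis by linarith
  qed
  have feasible: "x t \<in> X \<and> u t \<in> U"
    if costs: "costs_regular D U \<alpha>x lx \<alpha>u lu T fx fu" and steady: "minimizers_steady A B X U Xbar T fx fu"
      and run: "algorithm_run A B X U Xbar D \<delta> \<mu> \<gamma>x \<gamma>u x0 uinit v0 T fx fu x u"
      and t: "t \<in> {0..T}"
    for T fx fu x u t
  proof -
    obtain v uh where online_run: "online_run A B X Xbar U \<delta> \<mu> D \<alpha>x lx \<alpha>u lu \<gamma>x \<gamma>u T fx fu x v uh"
      and eq: "\<And>t. t \<le> T \<Longrightarrow> u t = uh t 1"
      using online[OF costs steady run] by blast
    from online_run.run_feasible[OF online_run, of t] show ?thesis
      using t eq[of t] mu_pos by (auto simp: feasible_from_def)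
  qed
  show ?thesis
  proof (intro conjI allI impI)
    fix G
    show "\<exists>C0>0. \<exists>C\<theta>>0. \<exists>C\<eta>>0. \<forall>T fx fu x u xs us.
        costs_regular D U \<alpha>x lx \<alpha>u lu T fx fu \<and>
        minimizers_steady A B X U Xbar T fx fu \<and>
        input_costs_lipschitz G U T fu \<and>
        algorithm_run A B X U Xbar D \<delta> \<mu> \<gamma>x \<gamma>u x0 uinit v0 T fx fu x u \<and>
        benchmark_solution A B X U x0 T fx fu xs us
        \<longrightarrow> regret T fx fu x u xs us
              \<le> C0 + C\<theta> * path_variation T (predicted A B \<mu> x0 uinit) (\<lambda>t. arg_min_on (fx t) X)
                   + C\<eta> * path_variation T v0 (\<lambda>t. arg_min_on (fu t) U)"
    proof (rule exI[of _ "\<bar>K0 G\<bar> + 1"], rule conjI, goal_cases)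
      case 2
      show ?case
        by (rule exI[of _ "\<bar>K\<theta> G\<bar> + 1"], rule conjI, simp add: add_nonneg_pos,
            rule exI[of _ "\<bar>K\<eta> G\<bar> + 1"], rule conjI, simp add: add_nonneg_pos,
            intro allI impI, elim conjE, rule bound)
    qed (simp add: add_nonneg_pos)
  qed (use feasible in blast)
qed

end
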